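(* Let $I$ be a dense linear order with a left endpoint $0$ and no right endpoint, and let $\mathcal{L}(I)$ be the structure described in the context. Then $\mathcal{L}(I)$ is model-complete: every first-order formula in its signature is equivalent in $\mathcal{L}(I)$ to an existential formula.
   Context: Let $\mathcal{P}_{\mathrm{fci}}(I)$ be the set of finite unions of closed intervals of $I$. Here a closed interval is a set of the form $[i,j]=\{k: i\le k\le j\}$, $[i,+\infty)=\{k: i\le k\}$ or $(-\infty,j]=\{k:k\le j\}$ with $i,j\in I$. Let $\mathcal{L}(I)$ be the structure with universe $\mathcal{P}_{\mathrm{fci}}(I)$ in the signature $\{\cup,\cap,\bot,c_0,\min,\max,l,r\}$, interpreted as follows. - $\cup$ and $\cap$ are union and intersection. - $\bot$ is $\emptyset$, and $c_0$ is $\{0\}$. - $\min(A)$ is the singleton of the least element of $A$, with $\min(\emptyset)=\emptyset$. - $\max(A)$ is the singleton of the greatest element of $A$ when $A$ is nonempty and bounded, and $\emptyset$ when $A$ is empty or unbounded. - $l(A)$ is the set of left endpoints of $A$, and $r(A)$ is the set of right endpoints of $A$. Endpoints are defined via the maximal closed intervals whose finite union is $A$. The left endpoints are the minima of these intervals. The right endpoints are the maxima of the bounded ones. *)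

theory Defs
  imports Main
begin

definition closed_intervals :: "'a::linorder set set" where
  "closed_intervals = {{i..j} | i j. True} \<union> {{i..} | i. True} \<union> {{..j} | j. True}"

definition fci :: "'a::linorder set set" where
  "fci = {\<Union>F | F. finite F \<and> F \<subseteq> closed_intervals}"

definition set_min :: "'a::linorder set \<Rightarrow> 'a set" where
  "set_min A = (if A = {} then {} else {LEAST x. x \<in> A})"

definition set_max :: "'a::linorder set \<Rightarrow> 'a set" where
  "set_max A = (if A \<noteq> {} \<and> (\<exists>b. \<forall>x\<in>A. x \<le> b) then {GREATEST x. x \<in> A} else {})"

definition max_intervals :: "'a::linorder set \<Rightarrow> 'a set set" where
  "max_intervals A = {C. C \<in> closed_intervals \<and> C \<noteq> {} \<and> C \<subseteq> A \<and>
      (\<forall>D\<in>closed_intervals. C \<subseteq> D \<and> D \<subseteq> A \<longrightarrow> D = C)}"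

definition left_ends :: "'a::linorder set \<Rightarrow> 'a set" where
  "left_ends A = {x. \<exists>C\<in>max_intervals A. x \<in> C \<and> (\<forall>y\<in>C. x \<le> y)}"

definition right_ends :: "'a::linorder set \<Rightarrow> 'a set" where
  "right_ends A = {x. \<exists>C\<in>max_intervals A. x \<in> C \<and> (\<forall>y\<in>C. y \<le> x)}"

datatype trm = V nat | TUn trm trm | TInt trm trm | TBot | TC0
  | TMin trm | TMax trm | TL trm | TR trm

datatype fm = FEq trm trm | FNeg fm | FAnd fm fm | FOr fm fm
  | FEx nat fm | FAll nat fm

primrec tvars :: "trm \<Rightarrow> nat set" where
  "tvars (V n) = {n}"
| "tvars (TUn s t) = tvars s \<union> tvars t"
| "tvars (TInt s t) = tvars s \<union> tvars t"
| "tvars TBot = {}"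
| "tvars TC0 = {}"
| "tvars (TMin t) = tvars t"
| "tvars (TMax t) = tvars t"
| "tvars (TL t) = tvars t"
| "tvars (TR t) = tvars t"

primrec fv :: "fm \<Rightarrow> nat set" where
  "fv (FEq s t) = tvars s \<union> tvars t"
| "fv (FNeg p) = fv p"
| "fv (FAnd p q) = fv p \<union> fv q"
| "fv (FOr p q) = fv p \<union> fv q"
| "fv (FEx x p) = fv p - {x}"
| "fv (FAll x p) = fv p - {x}"

primrec qfree :: "fm \<Rightarrow> bool" where
  "qfree (FEq s t) = True"
| "qfree (FNeg p) = qfree p"
| "qfree (FAnd p q) = (qfree p \<and> qfree q)"
| "qfree (FOr p q) = (qfree p \<and> qfree q)"
| "qfree (FEx x p) = False"
| "qfree (FAll x p) = False"

inductive existential :: "fm \<Rightarrow> bool" where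
  "qfree p \<Longrightarrow> existential p"
| "existential p \<Longrightarrow> existential (FEx x p)"

section \<open>Semantics in L(I); z is the left endpoint 0 of I\<close>

primrec teval :: "'a::linorder \<Rightarrow> (nat \<Rightarrow> 'a set) \<Rightarrow> trm \<Rightarrow> 'a set" where
  "teval z \<sigma> (V n) = \<sigma> n"
| "teval z \<sigma> (TUn s t) = teval z \<sigma> s \<union> teval z \<sigma> t"
| "teval z \<sigma> (TInt s t) = teval z \<sigma> s \<inter> teval z \<sigma> t"
| "teval z \<sigma> TBot = {}"
| "teval z \<sigma> TC0 = {z}"
| "teval z \<sigma> (TMin t) = set_min (teval z \<sigma> t)"
| "teval z \<sigma> (TMax t) = set_max (teval z \<sigma> t)"
| "teval z \<sigma> (TL t) = left_ends (teval z \<sigma> t)"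
| "teval z \<sigma> (TR t) = right_ends (teval z \<sigma> t)"

primrec sat :: "'a::linorder \<Rightarrow> (nat \<Rightarrow> 'a set) \<Rightarrow> fm \<Rightarrow> bool" where
  "sat z \<sigma> (FEq s t) = (teval z \<sigma> s = teval z \<sigma> t)"
| "sat z \<sigma> (FNeg p) = (\<not> sat z \<sigma> p)"
| "sat z \<sigma> (FAnd p q) = (sat z \<sigma> p \<and> sat z \<sigma> q)"
| "sat z \<sigma> (FOr p q) = (sat z \<sigma> p \<or> sat z \<sigma> q)"
| "sat z \<sigma> (FEx x p) = (\<exists>A\<in>fci. sat z (\<sigma>(x := A)) p)"
| "sat z \<sigma> (FAll x p) = (\<forall>A\<in>fci. sat z (\<sigma>(x := A)) p)"

end

theory Submission
  imports Defs
begin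

text \<open>Finitely many sets from fci cut the line into finitely many points and homogeneous open
  gaps, so a tuple of sets is a finite word, well defined up to inserting points into gaps.
  By induction on the formula, truth of a formula in L(I) is decided by a finite
  deterministic automaton reading this word. Quantification over a set is the subset construction
  combined with insertion of points, where density is used to realize every insertion; density also
  ensures that only the word matters and not the lengths of the gaps. Conversely, the
  existence of an accepting run is an existential statement: the run is stored in sets of fci that collect
  the cells carrying the same state and letter, and the transition conditions
  are Boolean combinations of equations between the left ends and right ends of these sets.\<close>

section \<open>Finite unions of closed intervals\<close>

text \<open>Determinism makes negation free, so any alternation of quantifiers collapses into one
  automaton, and one existential block that guesses its run replaces them all. The obstacle is that
  a tuple of sets has many words: \<open>recognizable\<close> therefore demands the right verdict on
  every word that decodes to the tuple, and every refinement of the point sequence has to be matched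
  by an insertion of letters. Function symbols disappear before automata are built: equality of
  terms becomes agreement on points, a point is a singleton in \<open>fci\<close>, and minimum,
  maximum and end points have first-order definitions over the order of points. Hence only inclusion
  and the comparison of two sets need automata written by hand. In the converse direction,
  neighbouring cells are closed and share a point, so the sets that store a run overlap at the cut
  points. There membership is ambiguous, and the left and right ends must tell which cell stops and
  which one starts.\<close>

locale dense_ray =
  fixes z :: "'a::linorder"
  assumes dense: "\<And>x y::'a. x < y \<Longrightarrow> \<exists>w. x < w \<and> w < y"
    and least: "\<And>x::'a. z \<le> x"
    and no_top: "\<And>x::'a. \<exists>y. x < y"
begin

text \<open>A ray to the left is the bounded interval that starts at \<open>z\<close>, so two shapes
  remain.\<close>

lemma closed_intervals_cases:
  assumes "C \<in> closed_intervals"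
  obtains i j :: 'a where "C = {i..j}" | i where "C = {i..}"
proof -
  have "{..j} = {z..j}" for j
    using least by auto
  then show thesis
    using assms that unfolding closed_intervals_def by blast
qed

lemma closed_intervals_Icc: "{i..j} \<in> closed_intervals"
  and closed_intervals_Ici: "{i..} \<in> closed_intervals"
  by (auto simp: closed_intervals_def)

lemma closed_intervals_Int:
  fixes C D :: "'a set"
  assumes "C \<in> closed_intervals" "D \<in> closed_intervals"
  shows "C \<inter> D \<in> closed_intervals"
  using assms(1)
proof (cases rule: closed_intervals_cases)
  case C: (1 i j)
  show ?thesis
    using assms(2)
  proof (cases rule: closed_intervals_cases)
    case (1 k l)
    then show ?thesis
      using C closed_intervals_Icc by simp
  next
    case (2 k)
    have "C \<inter> D = {max i k..j}"
      using C 2 by auto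
    then show ?thesis
      using closed_intervals_Icc by simp
  qed
next
  case C: (2 i)
  show ?thesis
    using assms(2)
  proof (cases rule: closed_intervals_cases)
    case (1 k l)
    have "C \<inter> D = {max i k..l}"
      using C 1 by auto
    then show ?thesis
      using closed_intervals_Icc by simp
  next
    case (2 k)
    have "C \<inter> D = {max i k..}"
      using C 2 by auto
    then show ?thesis
      using closed_intervals_Ici by simp
  qed
qed

lemma closed_intervals_Un:
  fixes C D :: "'a set"
  assumes "C \<in> closed_intervals" "D \<in> closed_intervals" "C \<inter> D \<noteq> {}"
  shows "C \<union> D \<in> closed_intervals"
  using assms(1)
proof (cases rule: closed_intervals_cases)
  case C: (1 i j)
  show ?thesis
    using assms(2)
  proof (cases rule: closed_intervals_cases)
    case (1 k l)
    have "C \<union> D = {min i k..max j l}"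
      using C 1 assms(3) by (auto simp: min_le_iff_disj le_max_iff_disj)
    then show ?thesis
      using closed_intervals_Icc by simp
  next
    case (2 k)
    have "C \<union> D = {min i k..}"
      using C 2 assms(3) by (auto simp: min_le_iff_disj)
    then show ?thesis
      using closed_intervals_Ici by simp
  qed
next
  case C: (2 i)
  show ?thesis
    using assms(2)
  proof (cases rule: closed_intervals_cases)
    case (1 k l)
    have "C \<union> D = {min i k..}"
      using C 1 assms(3) by (auto simp: min_le_iff_disj)
    then show ?thesis
      using closed_intervals_Ici by simp
  next
    case (2 k)
    have "C \<union> D = {min i k..}"
      using C 2 by (auto simp: min_le_iff_disj)
    then show ?thesis
      using closed_intervals_Ici by simp
  qed
qed

text \<open>All members meet the common interval \<open>D\<close>, so they can be attached to it one
  at a time without leaving a hole.\<close>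

lemma closed_intervals_Union:
  fixes D :: "'a set"
  assumes "finite F" "F \<subseteq> closed_intervals" "D \<in> closed_intervals" "\<And>C. C \<in> F \<Longrightarrow> C \<inter> D \<noteq> {}"
  shows "D \<union> \<Union>F \<in> closed_intervals"
  using assms
proof (induction F)
  case (insert C F)
  have "D \<union> \<Union>F \<in> closed_intervals"
    using insert.prems by (intro insert.IH) blast+
  moreover have "C \<in> closed_intervals" "C \<inter> D \<noteq> {}"
    using insert.prems by blast+
  ultimately have "(D \<union> \<Union>F) \<union> C \<in> closed_intervals"
    using closed_intervals_Un[of "D \<union> \<Union>F" C] by blast
  then show ?case
    by (simp add: Un_ac)
qed simp

lemma fci_empty: "{} \<in> (fci :: 'a set set)"
  unfolding fci_def by (auto intro!: exI[of _ "{}"])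

lemma fci_interval: "C \<in> closed_intervals \<Longrightarrow> C \<in> (fci :: 'a set set)"
  unfolding fci_def by (auto intro!: exI[of _ "{C}"])

lemma fci_Un:
  fixes A B :: "'a set"
  assumes "A \<in> fci" "B \<in> fci"
  shows "A \<union> B \<in> fci"
proof -
  obtain F G where "A = \<Union>F" "finite F" "F \<subseteq> closed_intervals"
    "B = \<Union>G" "finite G" "G \<subseteq> closed_intervals"
    using assms unfolding fci_def by auto
  then have "A \<union> B = \<Union>(F \<union> G)" "finite (F \<union> G)" "F \<union> G \<subseteq> closed_intervals"
    by auto
  then show ?thesis
    unfolding fci_def by blast
qed

lemma fci_UN:
  fixes f :: "'i \<Rightarrow> 'a set"
  shows "finite I \<Longrightarrow> (\<And>i. i \<in> I \<Longrightarrow> f i \<in> fci) \<Longrightarrow> (\<Union>i\<in>I. f i) \<in> fci"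
  by (induction I rule: finite_induct) (auto intro: fci_empty fci_Un)

lemma fci_Int:
  fixes A B :: "'a set"
  assumes "A \<in> fci" "B \<in> fci"
  shows "A \<inter> B \<in> fci"
proof -
  obtain F G where A: "A = \<Union>F" "finite F" "F \<subseteq> closed_intervals"
    and B: "B = \<Union>G" "finite G" "G \<subseteq> closed_intervals"
    using assms unfolding fci_def by auto
  have "A \<inter> B = (\<Union>C\<in>F. \<Union>D\<in>G. C \<inter> D)"
    using A(1) B(1) by auto
  then show ?thesis
    using A(2,3) B(2,3) by (simp only:) (intro fci_UN fci_interval closed_intervals_Int; auto)
qed

lemma fci_singleton: "{x} \<in> (fci :: 'a set set)"
  using fci_interval[OF closed_intervals_Icc[of x x]] by simp

lemma fci_finite: "finite A \<Longrightarrow> A \<in> (fci :: 'a set set)"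
  using fci_UN[of A "\<lambda>x. {x}"] fci_singleton by simp

lemma fci_induct [consumes 1, case_names empty Un]:
  fixes A :: "'a set"
  assumes "A \<in> fci" "P {}"
    and "\<And>A C. A \<in> fci \<Longrightarrow> P A \<Longrightarrow> C \<in> closed_intervals \<Longrightarrow> C \<noteq> {} \<Longrightarrow> P (A \<union> C)"
  shows "P A"
proof -
  obtain F where A: "A = \<Union>F" "finite F" "F \<subseteq> closed_intervals"
    using assms(1) unfolding fci_def by auto
  have "\<Union>F \<in> fci \<and> P (\<Union>F)"
    using A(2,3)
  proof (induction F)
    case empty
    then show ?case
      using assms(2) fci_empty by simp
  next
    case (insert C F)
    then show ?case
      using assms(3)[of "\<Union>F" C] fci_Un fci_interval
      by (cases "C = {}") (auto simp: Un_commute)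
  qed
  then show ?thesis
    using A(1) by simp
qed

lemma fci_has_least:
  fixes A :: "'a set"
  shows "A \<in> fci \<Longrightarrow> A \<noteq> {} \<Longrightarrow> \<exists>m\<in>A. \<forall>x\<in>A. m \<le> x"
proof (induction A rule: fci_induct)
  case (Un A C)
  obtain i where i: "i \<in> C" "\<forall>x\<in>C. i \<le> x"
    using Un.hyps(2)
  proof (cases rule: closed_intervals_cases)
    case (1 k l)
    then show thesis
      using Un.hyps(3) that[of k] by auto
  next
    case (2 k)
    then show thesis
      using that[of k] by auto
  qed
  show ?case
  proof (cases "A = {}")
    case False
    then obtain m where "m \<in> A" "\<forall>x\<in>A. m \<le> x"
      using Un.IH by auto
    then show ?thesis
      using i by (intro bexI[of _ "min m i"]) (use \<open>m \<in> A\<close> in \<open>auto simp: min_le_iff_disj min_def\<close>)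
  qed (use i in auto)
qed simp

lemma fci_has_greatest:
  fixes A :: "'a set"
  shows "A \<in> fci \<Longrightarrow> A \<noteq> {} \<Longrightarrow> \<forall>x\<in>A. x \<le> b \<Longrightarrow> \<exists>m\<in>A. \<forall>x\<in>A. x \<le> m"
proof (induction A rule: fci_induct)
  case (Un A C)
  obtain i where i: "i \<in> C" "\<forall>x\<in>C. x \<le> i"
    using Un.hyps(2)
  proof (cases rule: closed_intervals_cases)
    case (1 k l)
    then show thesis
      using Un.hyps(3) that[of l] by auto
  next
    \<comment> \<open>A ray exceeds every bound, as there is no greatest point; this case
      contradicts the bound \<open>b\<close>.\<close>
    case (2 k)
    obtain y where "max b k < y"
      using no_top by blast
    then have "y \<in> A \<union> C" "b < y"
      using 2 by auto
    then show thesis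
      using Un.prems(2) by force
  qed
  show ?case
  proof (cases "A = {}")
    case False
    then obtain m where "m \<in> A" "\<forall>x\<in>A. x \<le> m"
      using Un.IH Un.prems by auto
    then show ?thesis
      using i by (intro bexI[of _ "max m i"]) (use \<open>m \<in> A\<close> in \<open>auto simp: le_max_iff_disj max_def\<close>)
  qed (use i in auto)
qed simp

section \<open>Order-theoretic descriptions of minimum, maximum and end points\<close>

lemma mem_set_min_iff:
  fixes A :: "'a set"
  assumes "A \<in> fci"
  shows "a \<in> set_min A \<longleftrightarrow> a \<in> A \<and> (\<forall>b\<in>A. a \<le> b)"
proof (cases "A = {}")
  case False
  then obtain m where m: "m \<in> A" "\<forall>x\<in>A. m \<le> x"
    using fci_has_least assms by blast
  then have "(LEAST x. x \<in> A) = m"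
    by (intro Least_equality) auto
  then show ?thesis
    using m False by (auto simp: set_min_def intro: antisym)
qed (simp add: set_min_def)

text \<open>Boundedness drops out: an unbounded set has no greatest element, in agreement with the
  default value of \<open>set_max\<close>.\<close>

lemma mem_set_max_iff:
  fixes A :: "'a set"
  assumes "A \<in> fci"
  shows "a \<in> set_max A \<longleftrightarrow> a \<in> A \<and> (\<forall>b\<in>A. b \<le> a)"
proof (cases "A \<noteq> {} \<and> (\<exists>b. \<forall>x\<in>A. x \<le> b)")
  case True
  then obtain m where m: "m \<in> A" "\<forall>x\<in>A. x \<le> m"
    using fci_has_greatest assms by blast
  then have "(GREATEST x. x \<in> A) = m"
    by (intro Greatest_equality) auto
  then show ?thesis
    using m True by (auto simp: set_max_def intro: antisym)
qed (auto simp: set_max_def)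

text \<open>A maximal union of members of F that is an interval containing x cannot be enlarged:
  any larger interval D inside A extends to the union of all members of F that meet D.\<close>

lemma fci_max_interval:
  fixes A :: "'a set"
  assumes "A \<in> fci" "x \<in> A"
  shows "\<exists>C\<in>max_intervals A. x \<in> C"
proof -
  obtain F where F: "A = \<Union>F" "finite F" "F \<subseteq> closed_intervals"
    using assms(1) unfolding fci_def by auto
  define H where "H = {C \<in> Union ` Pow F. C \<in> closed_intervals \<and> x \<in> C}"
  have "finite H"
    using F(2) by (simp add: H_def)
  obtain C0 where "C0 \<in> F" "x \<in> C0"
    using assms(2) F(1) by auto
  then have "\<Union>{C0} \<in> Union ` Pow F" "C0 \<in> closed_intervals"
    using F(3) by auto
  then have "H \<noteq> {}"
    using \<open>x \<in> C0\<close> by (auto simp: H_def)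
  then obtain C where C: "C \<in> H" "\<And>D. D \<in> H \<Longrightarrow> C \<subseteq> D \<Longrightarrow> C = D"
    using finite_has_maximal[OF \<open>finite H\<close>] by metis
  have CA: "C \<in> closed_intervals" "x \<in> C" "C \<subseteq> A"
    using C(1) F(1) by (auto simp: H_def)
  have "D = C" if D: "D \<in> closed_intervals" "C \<subseteq> D" "D \<subseteq> A" for D
  proof -
    define G where "G = {E \<in> F. E \<inter> D \<noteq> {}}"
    have DG: "D \<subseteq> \<Union>G"
      using D(3) F(1) by (auto simp: G_def)
    have "D \<union> \<Union>G \<in> closed_intervals"
      using F D by (intro closed_intervals_Union) (auto simp: G_def)
    moreover have "D \<union> \<Union>G = \<Union>G" "x \<in> \<Union>G"
      using DG D(2) CA(2) by auto
    moreover have "G \<in> Pow F"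
      by (auto simp: G_def)
    ultimately have "\<Union>G \<in> H"
      unfolding H_def by auto
    then have "C = \<Union>G"
      using C(2) DG D(2) by blast
    then show ?thesis
      using D(2) DG by auto
  qed
  then show ?thesis
    using CA unfolding max_intervals_def by blast
qed

text \<open>The union of two overlapping intervals is an interval, so maximality of \<open>C\<close>
  absorbs \<open>D\<close>.\<close>

lemma max_intervals_extend:
  fixes A :: "'a set"
  assumes "C \<in> max_intervals A" "D \<in> closed_intervals" "D \<subseteq> A" "C \<inter> D \<noteq> {}"
  shows "D \<subseteq> C"
proof -
  have C: "C \<in> closed_intervals" "C \<subseteq> A"
    and max: "\<And>E. E \<in> closed_intervals \<Longrightarrow> C \<subseteq> E \<Longrightarrow> E \<subseteq> A \<Longrightarrow> E = C"
    using assms(1) by (auto simp: max_intervals_def)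
  have "C \<union> D = C"
    using max[OF closed_intervals_Un[OF C(1) assms(2,4)]] C(2) assms(3) by auto
  then show ?thesis
    by auto
qed

text \<open>Trades maximal intervals for a condition that quantifies over points only; automata for
  the end point operations are obtained from this form.\<close>

lemma mem_left_ends_iff:
  fixes A :: "'a set"
  assumes "A \<in> fci"
  shows "x \<in> left_ends A \<longleftrightarrow> x \<in> A \<and> \<not> (\<exists>y<x. {y..x} \<subseteq> A)"
proof (intro iffI conjI)
  assume "x \<in> left_ends A"
  then obtain C where C: "C \<in> max_intervals A" "x \<in> C" "\<forall>y\<in>C. x \<le> y"
    by (auto simp: left_ends_def)
  then show "x \<in> A"
    by (auto simp: max_intervals_def)
  show "\<not> (\<exists>y<x. {y..x} \<subseteq> A)"
  proof
    assume "\<exists>y<x. {y..x} \<subseteq> A"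
    then obtain y where "y < x" "{y..x} \<subseteq> A"
      by auto
    then have "{y..x} \<subseteq> C"
      using C(2) by (intro max_intervals_extend[OF C(1) closed_intervals_Icc]) auto
    then show False
      using C(3) \<open>y < x\<close> by (simp add: subset_iff) (meson leD order.refl order.strict_implies_order)
  qed
next
  assume x: "x \<in> A \<and> \<not> (\<exists>y<x. {y..x} \<subseteq> A)"
  then obtain C where C: "C \<in> max_intervals A" "x \<in> C"
    using fci_max_interval[OF assms] by blast
  have C': "C \<in> closed_intervals" "C \<subseteq> A"
    using C(1) by (auto simp: max_intervals_def)
  have "x \<le> y" if "y \<in> C" for y
  proof (rule ccontr)
    assume "\<not> x \<le> y"
    moreover have "{y..x} \<subseteq> C"
      using C'(1) by (cases rule: closed_intervals_cases) (use that C(2) in auto)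
    ultimately show False
      using x C'(2) by (metis linorder_not_le subset_trans)
  qed
  then show "x \<in> left_ends A"
    using C by (auto simp: left_ends_def)
qed

lemma mem_right_ends_iff:
  fixes A :: "'a set"
  assumes "A \<in> fci"
  shows "x \<in> right_ends A \<longleftrightarrow> x \<in> A \<and> \<not> (\<exists>y>x. {x..y} \<subseteq> A)"
proof (intro iffI conjI)
  assume "x \<in> right_ends A"
  then obtain C where C: "C \<in> max_intervals A" "x \<in> C" "\<forall>y\<in>C. y \<le> x"
    by (auto simp: right_ends_def)
  then show "x \<in> A"
    by (auto simp: max_intervals_def)
  show "\<not> (\<exists>y>x. {x..y} \<subseteq> A)"
  proof
    assume "\<exists>y>x. {x..y} \<subseteq> A"
    then obtain y where "y > x" "{x..y} \<subseteq> A"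
      by auto
    then have "{x..y} \<subseteq> C"
      using C(2) by (intro max_intervals_extend[OF C(1) closed_intervals_Icc]) auto
    then show False
      using C(3) \<open>y > x\<close> by (simp add: subset_iff) (meson leD order.refl order.strict_implies_order)
  qed
next
  assume x: "x \<in> A \<and> \<not> (\<exists>y>x. {x..y} \<subseteq> A)"
  then obtain C where C: "C \<in> max_intervals A" "x \<in> C"
    using fci_max_interval[OF assms] by blast
  have C': "C \<in> closed_intervals" "C \<subseteq> A"
    using C(1) by (auto simp: max_intervals_def)
  have "y \<le> x" if "y \<in> C" for y
  proof (rule ccontr)
    assume "\<not> y \<le> x"
    moreover have "{x..y} \<subseteq> C"
      using C'(1) by (cases rule: closed_intervals_cases) (use that C(2) in auto)
    ultimately show False
      using x C'(2) by (metis linorder_not_le subset_trans)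
  qed
  then show "x \<in> right_ends A"
    using C by (auto simp: right_ends_def)
qed

text \<open>The only candidates for ends of A are the ends of the intervals whose union is A.\<close>

lemma finite_left_ends:
  fixes A :: "'a set"
  assumes "A \<in> fci"
  shows "finite (left_ends A)"
proof -
  obtain F where F: "A = \<Union>F" "finite F" "F \<subseteq> closed_intervals"
    using assms unfolding fci_def by auto
  have "\<exists>C\<in>F. x = (LEAST y. y \<in> C)" if "x \<in> left_ends A" for x
  proof -
    have x: "x \<in> A" "\<not> (\<exists>y<x. {y..x} \<subseteq> A)"
      using that mem_left_ends_iff[OF assms] by auto
    obtain C where C: "C \<in> F" "x \<in> C"
      using x(1) F(1) by auto
    have "x \<le> y" if "y \<in> C" for y
    proof (rule ccontr)
      assume "\<not> x \<le> y"
      moreover have "C \<in> closed_intervals"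
        using C F by auto
      then have "{y..x} \<subseteq> C"
        by (cases rule: closed_intervals_cases) (use that C(2) in auto)
      ultimately show False
        using x C F(1) by (meson Sup_upper linorder_not_le subset_trans)
    qed
    then have "(LEAST y. y \<in> C) = x"
      using C by (intro Least_equality) auto
    then show ?thesis
      using C by auto
  qed
  then have "left_ends A \<subseteq> (\<lambda>C. LEAST y. y \<in> C) ` F"
    by auto
  then show ?thesis
    using F(2) finite_subset by blast
qed

lemma finite_right_ends:
  fixes A :: "'a set"
  assumes "A \<in> fci"
  shows "finite (right_ends A)"
proof -
  obtain F where F: "A = \<Union>F" "finite F" "F \<subseteq> closed_intervals"
    using assms unfolding fci_def by auto
  have "\<exists>C\<in>F. x = (GREATEST y. y \<in> C)" if "x \<in> right_ends A" for x
  proof -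
    have x: "x \<in> A" "\<not> (\<exists>y>x. {x..y} \<subseteq> A)"
      using that mem_right_ends_iff[OF assms] by auto
    obtain C where C: "C \<in> F" "x \<in> C"
      using x(1) F(1) by auto
    have "y \<le> x" if "y \<in> C" for y
    proof (rule ccontr)
      assume "\<not> y \<le> x"
      moreover have "C \<in> closed_intervals"
        using C F by auto
      then have "{x..y} \<subseteq> C"
        by (cases rule: closed_intervals_cases) (use that C(2) in auto)
      ultimately show False
        using x C F(1) by (meson Sup_upper linorder_not_le subset_trans)
    qed
    then have "(GREATEST y. y \<in> C) = x"
      using C by (intro Greatest_equality) auto
    then show ?thesis
      using C by auto
  qed
  then have "right_ends A \<subseteq> (\<lambda>C. GREATEST y. y \<in> C) ` F"
    by auto
  then show ?thesis
    using F(2) finite_subset by blast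
qed

lemma teval_fci: "(\<And>n. \<sigma> n \<in> fci) \<Longrightarrow> teval z \<sigma> t \<in> fci"
  by (induction t)
    (auto simp: fci_Un fci_Int fci_empty set_min_def set_max_def
      intro!: fci_finite finite_left_ends finite_right_ends)

end

section \<open>Words coding families of sets\<close>

type_synonym letter = "nat set \<times> nat set"

text \<open>The next point of \<open>E\<close> is included: a set in \<open>fci\<close> that
  contains an open gap contains its end points too, so closed cells and single points suffice as
  building blocks.\<close>

definition cell :: "'a::linorder set \<Rightarrow> 'a \<Rightarrow> 'a set" where
  "cell E x = {y. x \<le> y \<and> (\<forall>e\<in>E. x < e \<longrightarrow> y \<le> e)}"

text \<open>A word of letters written on the points of a finite increasing sequence codes a family of sets:
  the mark (x, p, g) puts the point x into the sets with index in p, and the closed cell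
  from x to the next marked point (or to infinity) into the sets with index in g.\<close>

definition val :: "('a::linorder \<times> letter) list \<Rightarrow> nat \<Rightarrow> 'a set" where
  "val ms n = {w. \<exists>(x, p, g)\<in>set ms. n \<in> p \<and> w = x \<or> n \<in> g \<and> w \<in> cell (fst ` set ms) x}"

definition increasing :: "('a::linorder \<times> letter) list \<Rightarrow> bool" where
  "increasing ms \<longleftrightarrow> sorted_wrt (<) (map fst ms)"

lemma increasing_Nil [simp]: "increasing []"
  by (simp add: increasing_def)

lemma increasing_Cons [simp]:
  "increasing (m # ms) \<longleftrightarrow> (\<forall>e\<in>fst ` set ms. fst m < e) \<and> increasing ms"
  by (auto simp: increasing_def)

lemma increasing_append:
  "increasing (ms @ ms') \<longleftrightarrow>
     increasing ms \<and> increasing ms' \<and> (\<forall>x\<in>fst ` set ms. \<forall>y\<in>fst ` set ms'. x < y)"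
  by (auto simp: increasing_def sorted_wrt_append)

lemma cell_self: "x \<in> cell E x"
  by (auto simp: cell_def)

lemma cell_insert_less: "x < e \<Longrightarrow> cell (insert x E) e = cell E e"
  by (auto simp: cell_def)

lemma cell_insert_self: "cell (insert x E) x = cell E x"
  by (auto simp: cell_def)

lemma cell_insert_next: "x < d \<Longrightarrow> \<forall>e\<in>E. d < e \<Longrightarrow> cell (insert d E) x = {x..d}"
  by (force simp: cell_def)

lemma cell_split: "x < d \<Longrightarrow> \<forall>e\<in>E. d < e \<Longrightarrow> cell E x = {x..d} \<union> cell E d"
  by (force simp: cell_def)

lemma cell_convex: "y \<in> cell E x \<Longrightarrow> x \<le> u \<Longrightarrow> u \<le> y \<Longrightarrow> u \<in> cell E x"
  by (auto simp: cell_def)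

lemma cell_cases:
  assumes "finite E"
  obtains e where "e \<in> E" "x < e" "cell E x = {x..e}" "\<forall>e'\<in>E. x < e' \<longrightarrow> e \<le> e'"
  | "\<forall>e\<in>E. e \<le> x" "cell E x = {x..}"
proof (cases "\<exists>e\<in>E. x < e")
  case True
  define e where "e = Min {e\<in>E. x < e}"
  have "e \<in> {e\<in>E. x < e}"
    unfolding e_def using True assms by (intro Min_in) auto
  moreover have "e \<le> e'" if "e' \<in> E" "x < e'" for e'
    unfolding e_def using that assms by (intro Min_le) auto
  moreover from calculation have "cell E x = {x..e}"
    by (auto simp: cell_def intro: order.trans)
  ultimately show thesis
    using that(1)[of e] by blast
next
  case False
  then show thesis
    using that(2) by (simp add: cell_def not_less atLeast_def leD)
qed

text \<open>Two different cells can share only the point where one closes and the other opens, and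
  that point belongs to \<open>E\<close>.\<close>

lemma cell_overlap:
  assumes "u \<in> E" "v \<in> E" "w \<in> cell E u" "w \<in> cell E v" "w \<notin> E"
  shows "u = v"
proof (rule linorder_cases)
  assume "u < v"
  then have "w = v"
    using assms by (auto simp: cell_def intro: antisym)
  then show ?thesis
    using assms by simp
next
  assume "v < u"
  then have "w = u"
    using assms by (auto simp: cell_def intro: antisym)
  then show ?thesis
    using assms by simp
qed

lemma val_Nil [simp]: "val [] n = {}"
  by (simp add: val_def)

text \<open>All points of \<open>ms\<close> lie above \<open>x\<close>, so putting \<open>x\<close>
  in front leaves their cells alone; this permits inductions along the word.\<close>

lemma val_Cons:
  assumes "increasing ((x, p, g) # ms)"
  shows "val ((x, p, g) # ms) n =
    (if n \<in> p then {x} else {}) \<union> (if n \<in> g then cell (fst ` set ms) x else {}) \<union> val ms n"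
proof -
  have "cell (insert x (fst ` set ms)) e = cell (fst ` set ms) e" if "(e, q, h) \<in> set ms" for e q h
    using that assms by (force intro!: cell_insert_less)
  then have "(\<exists>(e, q, h)\<in>set ms. n \<in> q \<and> w = e \<or> n \<in> h \<and> w \<in> cell (insert x (fst ` set ms)) e) \<longleftrightarrow>
      (\<exists>(e, q, h)\<in>set ms. n \<in> q \<and> w = e \<or> n \<in> h \<and> w \<in> cell (fst ` set ms) e)" for w
    by (intro bex_cong) auto
  then have "w \<in> val ((x, p, g) # ms) n \<longleftrightarrow>
      w \<in> (if n \<in> p then {x} else {}) \<union> (if n \<in> g then cell (fst ` set ms) x else {}) \<union> val ms n" for w
    by (simp add: val_def cell_insert_self)
  then show ?thesis
    by blast
qed

text \<open>The letters \<open>rs\<close> subdivide the gap after \<open>x\<close>. Their gaps must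
  copy \<open>g\<close>. Their point marks may contain \<open>n\<close> only if \<open>g\<close>
  does, since the point then lies in the closed gap anyway; otherwise a new isolated point would
  arise.\<close>

lemma val_block:
  assumes "increasing ((x, p, g) # rs @ ms)"
    and "\<forall>(d, p', g')\<in>set rs. (n \<in> g' \<longleftrightarrow> n \<in> g) \<and> (n \<in> p' \<longrightarrow> n \<in> g)"
  shows "val ((x, p, g) # rs @ ms) n =
    (if n \<in> p then {x} else {}) \<union> (if n \<in> g then cell (fst ` set ms) x else {}) \<union> val ms n"
  using assms
proof (induction rs arbitrary: x p g)
  case Nil
  then show ?case
    by (simp add: val_Cons)
next
  case (Cons r rs)
  obtain d p' g' where r: "r = (d, p', g')"
    by (cases r)
  have less: "x < d" "\<forall>e\<in>fst ` set (rs @ ms). d < e"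
    using Cons.prems(1) r by auto
  have IH: "val ((d, p', g') # rs @ ms) n =
    (if n \<in> p' then {d} else {}) \<union> (if n \<in> g' then cell (fst ` set ms) d else {}) \<union> val ms n"
    using Cons.prems r by (intro Cons.IH) auto
  have "val ((x, p, g) # (r # rs) @ ms) n = (if n \<in> p then {x} else {}) \<union>
      (if n \<in> g then cell (insert d (fst ` set (rs @ ms))) x else {}) \<union> val ((d, p', g') # rs @ ms) n"
    using Cons.prems(1) r by (simp add: val_Cons[of x p g])
  moreover have "cell (insert d (fst ` set (rs @ ms))) x = {x..d}"
    using less by (rule cell_insert_next)
  moreover have "cell (fst ` set ms) x = {x..d} \<union> cell (fst ` set ms) d"
    using less by (intro cell_split) auto
  moreover have "n \<in> g' \<longleftrightarrow> n \<in> g" "n \<in> p' \<Longrightarrow> n \<in> g"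
    using Cons.prems(2) r by auto
  ultimately show ?case
    using IH less(1) by auto
qed

context dense_ray
begin

text \<open>Cells extend to the right of their points, so starting at \<open>z\<close> makes them
  cover the whole order.\<close>

definition marking :: "('a \<times> letter) list \<Rightarrow> bool" where
  "marking ms \<longleftrightarrow> increasing ms \<and> ms \<noteq> [] \<and> fst (hd ms) = z"

lemma cell_closed_interval:
  fixes x :: 'a
  assumes "finite E"
  shows "cell E x \<in> closed_intervals"
  using assms by (rule cell_cases[of E x]) (simp_all add: closed_intervals_Icc closed_intervals_Ici)

lemma val_fci:
  fixes ms :: "('a \<times> letter) list"
  shows "val ms n \<in> fci"
proof -
  define f where "f m = (if n \<in> fst (snd m) then {fst m} else {}) \<union>
      (if n \<in> snd (snd m) then cell (fst ` set ms) (fst m) else {})" for m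
  have "w \<in> f m \<longleftrightarrow> n \<in> fst (snd m) \<and> w = fst m \<or> n \<in> snd (snd m) \<and> w \<in> cell (fst ` set ms) (fst m)" for w m
    by (simp add: f_def)
  then have "val ms n = (\<Union>m\<in>set ms. f m)"
    by (simp add: set_eq_iff val_def case_prod_beta)
  moreover have "f m \<in> fci" for m
    by (simp add: f_def fci_Un fci_singleton fci_empty fci_interval cell_closed_interval)
  ultimately show ?thesis
    by (simp add: fci_UN)
qed

section \<open>Cutting sets at finitely many points and refining words\<close>

lemma between_finite_right:
  fixes x y :: 'a
  assumes "finite E" "x < y"
  shows "\<exists>w. x < w \<and> w < y \<and> (\<forall>e\<in>E. x < e \<longrightarrow> w < e)"
  using assms(1)
proof (induction E)
  case empty
  then show ?case
    using dense[OF assms(2)] by auto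
next
  case (insert e E)
  then obtain w where w: "x < w" "w < y" "\<forall>e\<in>E. x < e \<longrightarrow> w < e"
    by blast
  obtain w' where "x < w'" "x < e \<longrightarrow> w' < e" "w' < w"
    using dense[of x w] dense[of x "min e w"] w(1) by (cases "x < e") auto
  then show ?case
    using w by (intro exI[of _ w']) auto
qed

lemma between_finite_left:
  fixes x y :: 'a
  assumes "finite E" "x < y"
  shows "\<exists>w. x < w \<and> w < y \<and> (\<forall>e\<in>E. e < y \<longrightarrow> e < w)"
  using assms(1)
proof (induction E)
  case empty
  then show ?case
    using dense[OF assms(2)] by auto
next
  case (insert e E)
  then obtain w where w: "x < w" "w < y" "\<forall>e\<in>E. e < y \<longrightarrow> e < w"
    by blast
  obtain w' where "w' < y" "e < y \<longrightarrow> e < w'" "w < w'"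
    using dense[of w y] dense[of "max e w" y] w(2) by (cases "e < y") auto
  then show ?case
    using w by (intro exI[of _ w']) auto
qed

lemma between_list:
  fixes x y :: 'a
  assumes "x < y"
  shows "\<exists>ds. length ds = k \<and> sorted_wrt (<) ds \<and> set ds \<subseteq> {x<..<y}"
  using assms
proof (induction k arbitrary: x)
  case (Suc k)
  obtain d where d: "x < d" "d < y"
    using dense Suc.prems by blast
  obtain ds where "length ds = k" "sorted_wrt (<) ds" "set ds \<subseteq> {d<..<y}"
    using Suc.IH d(2) by blast
  moreover from this have "\<forall>e\<in>set ds. x < e \<and> d < e \<and> e < y"
    using d(1) by fastforce
  ultimately show ?case
    using d by (intro exI[of _ "d # ds"]) auto
qed simp

lemma exists_cell:
  assumes "finite E" "z \<in> E"
  shows "\<exists>u\<in>E. w \<in> cell E u"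
proof -
  define u where "u = Max {e\<in>E. e \<le> w}"
  have "u \<in> {e\<in>E. e \<le> w}"
    unfolding u_def using assms least by (intro Max_in) auto
  moreover have "w \<le> e" if "e \<in> E" "u < e" for e
  proof (rule ccontr)
    assume "\<not> w \<le> e"
    then have "e \<le> u"
      unfolding u_def using that assms(1) by (intro Max_ge) auto
    then show False
      using that(2) by simp
  qed
  ultimately show ?thesis
    by (auto simp: cell_def)
qed

text \<open>This is what the gap component of a letter records. It does not mention the other points
  of the word, so a label computed from it stays right when points are inserted.\<close>

definition germ :: "'a set \<Rightarrow> 'a \<Rightarrow> bool" where
  "germ A x \<longleftrightarrow> (\<exists>e>x. {x..e} \<subseteq> A)"

text \<open>\<open>A\<close> is constant on the open gaps of \<open>E\<close>. Sampling at points of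
  \<open>E\<close> is excluded because adjacent closed cells share them.\<close>

definition adapted :: "'a set \<Rightarrow> 'a set \<Rightarrow> bool" where
  "adapted A E \<longleftrightarrow> (\<forall>u\<in>E. \<forall>w\<in>A. w \<in> cell E u \<and> w \<notin> E \<longrightarrow> cell E u \<subseteq> A)"

text \<open>The ends of the intervals whose union is \<open>A\<close> serve as \<open>D\<close>. All
  supersets are covered because these cuts are going to be added to points already present for other
  sets.\<close>

lemma fci_adapted:
  fixes A :: "'a set"
  assumes "A \<in> fci"
  shows "\<exists>D. finite D \<and> (\<forall>E. D \<subseteq> E \<longrightarrow> adapted A E)"
proof -
  have interval: "\<exists>D. finite D \<and> (\<forall>E. D \<subseteq> E \<longrightarrow> adapted C E)" if "C \<in> closed_intervals" for C
    using that
  proof (cases rule: closed_intervals_cases)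
    case (1 i j)
    \<comment> \<open>As \<open>w\<close> avoids \<open>E\<close>, it lies strictly between
      \<open>i\<close> and \<open>j\<close>. A cell opening left of \<open>i\<close> would close by
      \<open>i\<close> and miss \<open>w\<close>; a cell opening left of \<open>j\<close> closes by
      \<open>j\<close>.\<close>
    have "cell E u \<subseteq> C" if E: "{i, j} \<subseteq> E" "u \<in> E" and w: "w \<in> C" "w \<in> cell E u" "w \<notin> E" for E u w
    proof -
      have "i < w" "w < j" "u < w"
        using E w 1 by (auto simp: cell_def order.strict_iff_order)
      then have "i \<le> u" "u < j"
        using E w(2) by (force simp: cell_def)+
      then show ?thesis
        using E(1) 1 by (auto simp: cell_def)
    qed
    then show ?thesis
      unfolding adapted_def by (intro exI[of _ "{i, j}"]) blast
  next
    case (2 i)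
    have "cell E u \<subseteq> C" if E: "{i} \<subseteq> E" "u \<in> E" and w: "w \<in> C" "w \<in> cell E u" "w \<notin> E" for E u w
    proof -
      have "i < w" "u < w"
        using E w 2 by (auto simp: cell_def order.strict_iff_order)
      then have "i \<le> u"
        using E w(2) by (force simp: cell_def)
      then show ?thesis
        using 2 by (auto simp: cell_def)
    qed
    then show ?thesis
      unfolding adapted_def by (intro exI[of _ "{i}"]) blast
  qed
  show ?thesis
    using assms
  proof (induction A rule: fci_induct)
    case empty
    then show ?case
      by (auto simp: adapted_def)
  next
    case (Un A C)
    obtain D1 D2 where D: "finite D1" "\<forall>E. D1 \<subseteq> E \<longrightarrow> adapted A E"
        "finite D2" "\<forall>E. D2 \<subseteq> E \<longrightarrow> adapted C E"
      using Un.IH interval[OF Un.hyps(2)] by blast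
    have "adapted (A \<union> C) E" if "D1 \<union> D2 \<subseteq> E" for E
    proof -
      have "adapted A E" "adapted C E"
        using D that by auto
      then show ?thesis
        unfolding adapted_def by blast
    qed
    then show ?case
      using D(1,3) by (intro exI[of _ "D1 \<union> D2"]) blast
  qed
qed

text \<open>By density, a germ contains a sample point of the open gap, and adaptedness spreads from
  one sample point to the whole cell.\<close>

lemma germ_cell:
  assumes "finite E" "u \<in> E" "adapted A E"
  shows "germ A u \<longleftrightarrow> cell E u \<subseteq> A"
proof
  assume "germ A u"
  then obtain e where e: "u < e" "{u..e} \<subseteq> A"
    by (auto simp: germ_def)
  obtain w where w: "u < w" "w < e" "\<forall>e\<in>E. u < e \<longrightarrow> w < e"
    using between_finite_right[OF assms(1) e(1)] by blast
  then have "w \<in> {u..e}" "w \<in> cell E u" "w \<notin> E"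
    by (auto simp: cell_def)
  then have "w \<in> A" "w \<in> cell E u" "w \<notin> E"
    using e(2) by auto
  then show "cell E u \<subseteq> A"
    using assms(2,3) unfolding adapted_def by blast
next
  assume sub: "cell E u \<subseteq> A"
  obtain y where "u < y"
    using no_top by blast
  then obtain w where w: "u < w" "\<forall>e\<in>E. u < e \<longrightarrow> w < e"
    using between_finite_right[OF assms(1)] by blast
  then have "{u..w} \<subseteq> cell E u"
    by (force simp: cell_def)
  then show "germ A u"
    using w(1) sub unfolding germ_def by blast
qed

lemma adapted_decomposition:
  assumes "finite E" "z \<in> E" "adapted A E"
  shows "w \<in> A \<longleftrightarrow> (\<exists>u\<in>E. u \<in> A \<and> w = u \<or> germ A u \<and> w \<in> cell E u)"
proof
  assume "w \<in> A"
  show "\<exists>u\<in>E. u \<in> A \<and> w = u \<or> germ A u \<and> w \<in> cell E u"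
  proof (cases "w \<in> E")
    case True
    then show ?thesis
      using \<open>w \<in> A\<close> by blast
  next
    case False
    obtain u where u: "u \<in> E" "w \<in> cell E u"
      using exists_cell[OF assms(1,2)] by blast
    then have "cell E u \<subseteq> A"
      using False \<open>w \<in> A\<close> assms(3) unfolding adapted_def by blast
    then show ?thesis
      using u germ_cell[OF assms(1) u(1) assms(3)] by blast
  qed
next
  assume "\<exists>u\<in>E. u \<in> A \<and> w = u \<or> germ A u \<and> w \<in> cell E u"
  then show "w \<in> A"
    using germ_cell[OF assms(1) _ assms(3)] by auto
qed

lemma val_of_marks:
  assumes "marking ms" "adapted A (fst ` set ms)"
    and "\<forall>m\<in>set ms. (v \<in> fst (snd m) \<longleftrightarrow> fst m \<in> A) \<and> (v \<in> snd (snd m) \<longleftrightarrow> germ A (fst m))"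
  shows "val ms v = A"
proof (rule set_eqI)
  fix w
  have "z \<in> fst ` set ms"
    using assms(1) by (auto simp: marking_def intro!: image_eqI[of _ fst "hd ms"])
  then have "w \<in> A \<longleftrightarrow> (\<exists>u\<in>fst ` set ms. u \<in> A \<and> w = u \<or> germ A u \<and> w \<in> cell (fst ` set ms) u)"
    by (intro adapted_decomposition assms(2)) simp_all
  moreover have "w \<in> val ms v \<longleftrightarrow>
      (\<exists>m\<in>set ms. fst m \<in> A \<and> w = fst m \<or> germ A (fst m) \<and> w \<in> cell (fst ` set ms) (fst m))"
    unfolding val_def mem_Collect_eq using assms(3) by (intro bex_cong) (auto simp: case_prod_beta)
  ultimately show "w \<in> val ms v \<longleftrightarrow> w \<in> A"
    by blast
qed

text \<open>The words that can replace one letter when the point sequence is refined and membership in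
  the set with index v is changed arbitrarily.\<close>

definition blocks :: "nat \<Rightarrow> letter \<Rightarrow> letter list set" where
  "blocks v a = {(p, g) # r | p g r. p - {v} = fst a - {v} \<and> g - {v} = snd a - {v} \<and>
     (\<forall>(p', g')\<in>set r. p' - {v} \<subseteq> snd a \<and> g' - {v} = snd a - {v})}"

text \<open>The lower bound on new points leaves room for prepending a further block in an
  induction; keeping the first point preserves \<open>marking\<close>.\<close>

definition refines :: "nat \<Rightarrow> ('a \<times> letter) list \<Rightarrow> ('a \<times> letter) list \<Rightarrow> bool" where
  "refines v ms ms' \<longleftrightarrow> increasing ms' \<and>
     (ms \<noteq> [] \<longrightarrow> ms' \<noteq> [] \<and> fst (hd ms') = fst (hd ms)) \<and>
     fst ` set ms \<subseteq> fst ` set ms' \<and> (\<forall>e\<in>fst ` set ms'. \<exists>x\<in>fst ` set ms. x \<le> e) \<and>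
     (\<forall>n. n \<noteq> v \<longrightarrow> val ms' n = val ms n)"

lemma refines_Nil: "refines v [] []"
  by (simp add: refines_def)

lemma refines_Cons:
  assumes inc: "increasing ((x, p, g) # ms)" and ref: "refines v ms ms'"
    and block: "map snd ((x, p', g') # rs) \<in> blocks v (p, g)"
    and rs: "increasing rs" "\<forall>d\<in>fst ` set rs. x < d \<and> (\<forall>e\<in>fst ` set ms. d < e)"
  shows "refines v ((x, p, g) # ms) ((x, p', g') # rs @ ms')"
proof -
  have ms': "increasing ms'" "fst ` set ms \<subseteq> fst ` set ms'"
      "\<forall>e\<in>fst ` set ms'. \<exists>x\<in>fst ` set ms. x \<le> e" "\<And>n. n \<noteq> v \<Longrightarrow> val ms' n = val ms n"
    using ref by (auto simp: refines_def)
  have less: "\<forall>e\<in>fst ` set ms. x < e"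
    using inc by simp
  have less': "\<forall>e\<in>fst ` set ms'. x < e" "\<forall>d\<in>fst ` set rs. \<forall>e\<in>fst ` set ms'. d < e"
    using ms'(3) less rs(2) by (meson order_less_le_trans)+
  have inc': "increasing ((x, p', g') # rs @ ms')"
    using less' rs ms'(1) by (auto simp: increasing_append)
  \<comment> \<open>The old points recur among the new ones and bound them from below, so both lists
    close the cell of \<open>x\<close> at the same place.\<close>
  have cells: "cell (fst ` set ms') x = cell (fst ` set ms) x"
    using ms'(2,3) less unfolding cell_def by (meson order.trans subsetD less'(1))
  have "val ((x, p', g') # rs @ ms') n = val ((x, p, g) # ms) n" if "n \<noteq> v" for n
  proof -
    have pg: "n \<in> p' \<longleftrightarrow> n \<in> p" "n \<in> g' \<longleftrightarrow> n \<in> g"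
      using block that by (auto simp: blocks_def)
    have "(n \<in> h \<longleftrightarrow> n \<in> g) \<and> (n \<in> q \<longrightarrow> n \<in> g)" if "(d, q, h) \<in> set rs" for d q h
    proof -
      have "\<forall>l\<in>set rs. fst (snd l) - {v} \<subseteq> g \<and> snd (snd l) - {v} = g - {v}"
        using block by (simp add: blocks_def case_prod_beta)
      then have "q - {v} \<subseteq> g" "h - {v} = g - {v}"
        using that by (metis fst_conv snd_conv)+
      then show ?thesis
        using \<open>n \<noteq> v\<close> by blast
    qed
    then have "val ((x, p', g') # rs @ ms') n = (if n \<in> p' then {x} else {}) \<union>
        (if n \<in> g' then cell (fst ` set ms') x else {}) \<union> val ms' n"
      using pg by (intro val_block inc') auto
    then show ?thesis
      using val_Cons[OF inc] pg cells ms'(4)[OF that] by simp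
  qed
  moreover have "\<exists>e'\<in>insert x (fst ` set ms). e' \<le> e" if "e \<in> fst ` set ((x, p', g') # rs @ ms')" for e
  proof -
    have "x \<le> e"
      using that inc' by (auto intro: less_imp_le)
    then show ?thesis
      by blast
  qed
  ultimately show ?thesis
    unfolding refines_def using inc' ms'(2) by auto
qed

text \<open>Here density enters: every gap has room for any finite number of points, so every choice
  of blocks comes from an actual refinement.\<close>

lemma realize_blocks:
  assumes "increasing ms" "list_all2 (\<lambda>a u. u \<in> blocks v a) (map snd ms) us"
  shows "\<exists>ms'. map snd ms' = concat us \<and> refines v ms ms'"
  using assms
proof (induction ms arbitrary: us)
  case Nil
  then show ?case
    using refines_Nil by auto
next
  case (Cons m ms)
  obtain x p g where m: "m = (x, p, g)"
    by (cases m)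
  obtain u us' where us: "us = u # us'" "u \<in> blocks v (p, g)"
      "list_all2 (\<lambda>a u. u \<in> blocks v a) (map snd ms) us'"
    using Cons.prems(2) m by (auto simp: list_all2_Cons1)
  obtain p' g' r where u: "u = (p', g') # r"
    using us(2) by (auto simp: blocks_def)
  obtain ms' where ms': "map snd ms' = concat us'" "refines v ms ms'"
    using Cons.IH[OF _ us(3)] Cons.prems(1) by auto
  \<comment> \<open>\<open>y\<close> limits the room for the new points: it is the next point, or
    any larger one if \<open>x\<close> is the last.\<close>
  obtain y where y: "x < y" "\<forall>e\<in>fst ` set ms. y \<le> e"
  proof (cases ms)
    case Nil
    then show thesis
      using no_top[of x] that by auto
  next
    case (Cons m' ms0)
    then show thesis
      using that[of "fst m'"] Cons.prems(1) m by (auto intro: less_imp_le)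
  qed
  obtain ds where ds: "length ds = length r" "sorted_wrt (<) ds" "set ds \<subseteq> {x<..<y}"
    using between_list[OF y(1)] by blast
  have "map fst (zip ds r) = ds" "map snd (zip ds r) = r"
    using ds(1) by simp_all
  moreover from this have "fst ` set (zip ds r) = set ds"
    by (metis set_map)
  then have "\<forall>d\<in>fst ` set (zip ds r). x < d \<and> (\<forall>e\<in>fst ` set ms. d < e)"
    using ds(3) y(2) by fastforce
  ultimately have "refines v (m # ms) ((x, p', g') # zip ds r @ ms')"
    unfolding m using ds(2) us(2) u ms'(2) Cons.prems(1) m
    by (intro refines_Cons) (simp_all add: increasing_def)
  then show ?case
    using ms'(1) us(1) u \<open>map snd (zip ds r) = r\<close>
    by (intro exI[of _ "(x, p', g') # zip ds r @ ms'"]) simp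
qed

text \<open>The opposite of \<open>realize_blocks\<close>: cuts are prescribed, and the labels for
  \<open>v\<close> are read off from \<open>A\<close>. Cuts below the first point cannot be
  inserted, hence the restriction on \<open>D\<close>; the induction needs it because the tail sees
  only the cuts from its own first point on.\<close>

lemma refine_marks:
  assumes "increasing ms" "finite D"
  shows "\<exists>ms' us. map snd ms' = concat us \<and> list_all2 (\<lambda>a u. u \<in> blocks v a) (map snd ms) us \<and>
     refines v ms ms' \<and> {d\<in>D. \<exists>x\<in>fst ` set ms. x \<le> d} \<subseteq> fst ` set ms' \<and>
     (\<forall>m\<in>set ms'. (v \<in> fst (snd m) \<longleftrightarrow> fst m \<in> A) \<and> (v \<in> snd (snd m) \<longleftrightarrow> germ A (fst m)))"
  using assms(1)
proof (induction ms)
  case Nil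
  then show ?case
    using refines_Nil by (intro exI[of _ "[]"]) auto
next
  case (Cons m ms)
  obtain x p g where m: "m = (x, p, g)"
    by (cases m)
  obtain ms' us where ms': "map snd ms' = concat us"
      "list_all2 (\<lambda>a u. u \<in> blocks v a) (map snd ms) us" "refines v ms ms'"
      "{d\<in>D. \<exists>x\<in>fst ` set ms. x \<le> d} \<subseteq> fst ` set ms'"
      "\<forall>m\<in>set ms'. (v \<in> fst (snd m) \<longleftrightarrow> fst m \<in> A) \<and> (v \<in> snd (snd m) \<longleftrightarrow> germ A (fst m))"
    using Cons by auto
  \<comment> \<open>An old point passes its own marks as \<open>q\<close>, an inserted one passes
    \<open>{}\<close>: it belongs to the other sets through the closed gap around it. Only the entry
    for \<open>v\<close> is recomputed.\<close>
  define lab where "lab q y = (q - {v} \<union> (if y \<in> A then {v} else {}), g - {v} \<union> (if germ A y then {v} else {}))" for q y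
  define K where "K = {d\<in>D. x < d \<and> (\<forall>e\<in>fst ` set ms. d < e)}"
  define rs where "rs = map (\<lambda>d. (d, lab {} d)) (sorted_list_of_set K)"
  have K: "finite K"
    using assms(2) by (simp add: K_def)
  have fst_rs: "map fst rs = sorted_list_of_set K"
    by (simp add: rs_def o_def)
  have set_rs: "fst ` set rs = K"
    using K by (simp add: rs_def image_image)
  have block: "map snd ((x, lab p x) # rs) \<in> blocks v (p, g)"
    unfolding blocks_def lab_def rs_def by auto
  have "refines v (m # ms) ((x, lab p x) # rs @ ms')"
  proof -
    have "refines v ((x, p, g) # ms) ((x, fst (lab p x), snd (lab p x)) # rs @ ms')"
      using block Cons.prems m ms'(3)
      by (intro refines_Cons) (auto simp: set_rs increasing_def fst_rs K_def)
    then show ?thesis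
      by (simp add: m)
  qed
  moreover have "{d\<in>D. \<exists>y\<in>fst ` set (m # ms). y \<le> d} \<subseteq> fst ` set ((x, lab p x) # rs @ ms')"
  proof
    fix d
    assume d: "d \<in> {d\<in>D. \<exists>y\<in>fst ` set (m # ms). y \<le> d}"
    then have "x \<le> d"
      using Cons.prems m by force
    then consider "d = x" | "d \<in> K" | e where "e \<in> fst ` set ms" "e \<le> d"
      using d unfolding K_def by force
    then show "d \<in> fst ` set ((x, lab p x) # rs @ ms')"
    proof cases
      case 3
      then have "d \<in> fst ` set ms'"
        using d ms'(4) by blast
      then show ?thesis
        by (simp add: image_Un)
    qed (simp_all add: image_Un set_rs)
  qed
  moreover have "\<forall>m\<in>set ((x, lab p x) # rs @ ms'). (v \<in> fst (snd m) \<longleftrightarrow> fst m \<in> A) \<and> (v \<in> snd (snd m) \<longleftrightarrow> germ A (fst m))"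
  proof -
    have "v \<in> fst (lab q y) \<longleftrightarrow> y \<in> A" "v \<in> snd (lab q y) \<longleftrightarrow> germ A y" for q y
      by (simp_all add: lab_def)
    then show ?thesis
      using ms'(5) by (auto simp: rs_def)
  qed
  moreover have "map snd ((x, lab p x) # rs @ ms') = concat ((map snd ((x, lab p x) # rs)) # us)"
    using ms'(1) by simp
  moreover have "list_all2 (\<lambda>a u. u \<in> blocks v a) (map snd (m # ms)) (map snd ((x, lab p x) # rs) # us)"
    using block ms'(2) m by simp
  ultimately show ?case
    by blast
qed

lemma marking_refine:
  assumes "marking ms" "A \<in> fci"
  shows "\<exists>ms' us. map snd ms' = concat us \<and> list_all2 (\<lambda>a u. u \<in> blocks v a) (map snd ms) us \<and>
     marking ms' \<and> val ms' = (val ms)(v := A)"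
proof -
  obtain D where D: "finite D" "\<forall>E. D \<subseteq> E \<longrightarrow> adapted A E"
    using fci_adapted[OF assms(2)] by blast
  obtain ms' us where ms': "map snd ms' = concat us"
      "list_all2 (\<lambda>a u. u \<in> blocks v a) (map snd ms) us" "refines v ms ms'"
      "{d\<in>D. \<exists>x\<in>fst ` set ms. x \<le> d} \<subseteq> fst ` set ms'"
      "\<forall>m\<in>set ms'. (v \<in> fst (snd m) \<longleftrightarrow> fst m \<in> A) \<and> (v \<in> snd (snd m) \<longleftrightarrow> germ A (fst m))"
    using refine_marks[of ms D v A] assms(1) D(1) by (auto simp: marking_def)
  have "z \<in> fst ` set ms"
    using assms(1) by (auto simp: marking_def intro!: image_eqI[of _ fst "hd ms"])
  \<comment> \<open>Every cut lies above \<open>z\<close>, which is a point of \<open>ms\<close>, so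
    the restriction on \<open>D\<close> is void.\<close>
  then have "D \<subseteq> fst ` set ms'"
    using ms'(4) least by blast
  moreover have "marking ms'"
    using assms(1) ms'(3) by (auto simp: marking_def refines_def)
  ultimately have "val ms' v = A"
    using val_of_marks[of ms' A v] D(2) ms'(5) by blast
  then have "val ms' = (val ms)(v := A)"
    using ms'(3) by (intro ext) (simp add: refines_def)
  then show ?thesis
    using ms'(1,2) \<open>marking ms'\<close> by blast
qed

text \<open>The word for empty sets is refined for one variable after another; each brings finitely
  many cuts, which is why \<open>W\<close> is finite.\<close>

lemma marking_exists:
  assumes "finite W" "\<And>n. \<sigma> n \<in> fci"
  shows "\<exists>ms. marking ms \<and> (\<forall>n\<in>W. val ms n = \<sigma> n)"
  using assms(1)
proof (induction W)
  case empty
  have "marking [(z, {}, {})]"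
    by (simp add: marking_def)
  then show ?case
    by blast
next
  case (insert v W)
  then obtain ms where ms: "marking ms" "\<forall>n\<in>W. val ms n = \<sigma> n"
    by blast
  obtain ms' where "marking ms'" "val ms' = (val ms)(v := \<sigma> v)"
    using marking_refine[OF ms(1) assms(2)] by blast
  then show ?case
    using ms(2) by (intro exI[of _ ms']) auto
qed

section \<open>Recognizable predicates\<close>

text \<open>States are numbers because a formula of HOL cannot quantify over state types;
  \<open>recognizableI\<close> admits any finite set of states. The alphabet is infinite here and is
  cut down to the free variables only when runs are coded.\<close>

definition recognizable :: "((nat \<Rightarrow> 'a set) \<Rightarrow> bool) \<Rightarrow> bool" where
  "recognizable R \<longleftrightarrow> (\<exists>(N::nat) \<delta> q0 F. q0 < N \<and> (\<forall>q<N. \<forall>a. \<delta> q a < N) \<and>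
     (\<forall>ms. marking ms \<longrightarrow> (R (val ms) \<longleftrightarrow> foldl \<delta> q0 (map snd ms) \<in> F)))"

lemma foldl_closed: "(\<And>q a. q \<in> Q \<Longrightarrow> \<delta> q a \<in> Q) \<Longrightarrow> q \<in> Q \<Longrightarrow> foldl \<delta> q w \<in> Q"
  by (induction w arbitrary: q) auto

lemma recognizableI:
  assumes "finite Q" "q0 \<in> Q" and closed: "\<And>q a. q \<in> Q \<Longrightarrow> \<delta> q a \<in> Q"
    and acc: "\<And>ms. marking ms \<Longrightarrow> R (val ms) \<longleftrightarrow> foldl \<delta> q0 (map snd ms) \<in> F"
  shows "recognizable R"
proof -
  obtain h where h: "bij_betw h Q {0..<card Q}"
    using ex_bij_betw_finite_nat[OF assms(1)] by blast
  define \<delta>' where "\<delta>' n a = h (\<delta> (inv_into Q h n) a)" for n a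
  have inv: "inv_into Q h (h q) = q" if "q \<in> Q" for q
    using h that by (simp add: bij_betw_def inv_into_f_f)
  have less: "h q < card Q" if "q \<in> Q" for q
    using h that by (auto simp: bij_betw_def)
  have mem: "inv_into Q h n \<in> Q" if "n < card Q" for n
    using h that by (auto simp: bij_betw_def intro: inv_into_into)
  have fold: "foldl \<delta>' (h q) w = h (foldl \<delta> q w)" if "q \<in> Q" for q w
    using that by (induction w arbitrary: q) (simp_all add: \<delta>'_def inv closed)
  have "h q \<in> h ` (F \<inter> Q) \<longleftrightarrow> q \<in> F" if "q \<in> Q" for q
    using that h by (auto simp: bij_betw_def dest: inj_onD)
  then have "R (val ms) \<longleftrightarrow> foldl \<delta>' (h q0) (map snd ms) \<in> h ` (F \<inter> Q)" if "marking ms" for ms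
    using acc[OF that] fold[OF assms(2)] foldl_closed[of Q \<delta>, OF closed assms(2)] by simp
  moreover have "h q0 < card Q" "\<forall>q<card Q. \<forall>a. \<delta>' q a < card Q"
    using less assms(2) by (auto simp: \<delta>'_def closed mem)
  ultimately show ?thesis
    unfolding recognizable_def by blast
qed

text \<open>Words decode to families in \<open>fci\<close>, so agreement there is enough.\<close>

lemma recognizable_cong:
  assumes "recognizable R" "\<And>\<sigma>. (\<And>n. \<sigma> n \<in> fci) \<Longrightarrow> R' \<sigma> \<longleftrightarrow> R \<sigma>"
  shows "recognizable R'"
  using assms(1) assms(2)[OF val_fci] by (simp add: recognizable_def)

lemma recognizable_not:
  assumes "recognizable R"
  shows "recognizable (\<lambda>\<sigma>. \<not> R \<sigma>)"
proof -
  obtain N \<delta> q0 F where "q0 < (N::nat)" "\<forall>q<N. \<forall>a. \<delta> q a < N"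
    "\<forall>ms. marking ms \<longrightarrow> (R (val ms) \<longleftrightarrow> foldl \<delta> q0 (map snd ms) \<in> F)"
    using assms unfolding recognizable_def by blast
  then show ?thesis
    by (intro recognizableI[of "{..<N}" q0 \<delta> _ "- F"]) auto
qed

lemma foldl_pair:
  "foldl (\<lambda>(q, q') a. (\<delta> q a, \<delta>' q' a)) (q, q') w = (foldl \<delta> q w, foldl \<delta>' q' w)"
  by (induction w arbitrary: q q') auto

lemma recognizable_conj:
  assumes "recognizable R" "recognizable R'"
  shows "recognizable (\<lambda>\<sigma>. R \<sigma> \<and> R' \<sigma>)"
proof -
  obtain N \<delta> q0 F where 1: "q0 < (N::nat)" "\<forall>q<N. \<forall>a. \<delta> q a < N"
    "\<forall>ms. marking ms \<longrightarrow> (R (val ms) \<longleftrightarrow> foldl \<delta> q0 (map snd ms) \<in> F)"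
    using assms(1) unfolding recognizable_def by blast
  obtain N' \<delta>' q0' F' where 2: "q0' < (N'::nat)" "\<forall>q<N'. \<forall>a. \<delta>' q a < N'"
    "\<forall>ms. marking ms \<longrightarrow> (R' (val ms) \<longleftrightarrow> foldl \<delta>' q0' (map snd ms) \<in> F')"
    using assms(2) unfolding recognizable_def by blast
  show ?thesis
  proof (rule recognizableI)
    show "finite ({..<N} \<times> {..<N'})" "(q0, q0') \<in> {..<N} \<times> {..<N'}"
      using 1(1) 2(1) by auto
    show "(\<lambda>(q, q') a. (\<delta> q a, \<delta>' q' a)) q a \<in> {..<N} \<times> {..<N'}" if "q \<in> {..<N} \<times> {..<N'}" for q a
      using that 1(2) 2(2) by (cases q) (simp del: split_paired_All)
    show "(R (val ms) \<and> R' (val ms)) \<longleftrightarrow>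
        foldl (\<lambda>(q, q') a. (\<delta> q a, \<delta>' q' a)) (q0, q0') (map snd ms) \<in> F \<times> F'" if "marking ms" for ms
      using that 1(3) 2(3) by (simp add: foldl_pair)
  qed
qed

lemma recognizable_disj:
  assumes "recognizable R" "recognizable R'"
  shows "recognizable (\<lambda>\<sigma>. R \<sigma> \<or> R' \<sigma>)"
  using recognizable_not[OF recognizable_conj[OF recognizable_not[OF assms(1)] recognizable_not[OF assms(2)]]]
  by simp

lemma recognizable_iff:
  assumes "recognizable R" "recognizable R'"
  shows "recognizable (\<lambda>\<sigma>. R \<sigma> \<longleftrightarrow> R' \<sigma>)"
  using recognizable_disj[OF recognizable_conj[OF assms]
      recognizable_conj[OF recognizable_not[OF assms(1)] recognizable_not[OF assms(2)]]]
  by (rule recognizable_cong) blast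

text \<open>Stated for an arbitrary substitution of the language \<open>B a\<close> for the letter
  \<open>a\<close>. The languages may be infinite, since only the reachable states are kept.\<close>

lemma foldl_subset_construction:
  "foldl (\<lambda>S a. {foldl \<delta> s u | s u. s \<in> S \<and> u \<in> B a}) S w =
     {foldl \<delta> s (concat us) | s us. s \<in> S \<and> list_all2 (\<lambda>a u. u \<in> B a) w us}"
proof (induction w arbitrary: S)
  case Nil
  then show ?case
    by simp
next
  case (Cons a w)
  have "{foldl \<delta> s (concat us) | s us. s \<in> {foldl \<delta> s u | s u. s \<in> S \<and> u \<in> B a} \<and> list_all2 (\<lambda>a u. u \<in> B a) w us} =
      {foldl \<delta> s (concat us) | s us. s \<in> S \<and> list_all2 (\<lambda>a u. u \<in> B a) (a # w) us}" (is "?L = ?R")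
  proof (intro equalityI subsetI)
    fix q
    assume "q \<in> ?L"
    then obtain s u us where "s \<in> S" "u \<in> B a" "list_all2 (\<lambda>a u. u \<in> B a) w us"
        "q = foldl \<delta> s (concat (u # us))"
      by auto
    then show "q \<in> ?R"
      by blast
  next
    fix q
    assume "q \<in> ?R"
    then obtain s u us where "s \<in> S" "u \<in> B a" "list_all2 (\<lambda>a u. u \<in> B a) w us"
        "q = foldl \<delta> (foldl \<delta> s u) (concat us)"
      by (auto simp: list_all2_Cons1)
    then show "q \<in> ?L"
      by blast
  qed
  then show ?case
    using Cons.IH by simp
qed

text \<open>Subset construction; a single letter is replaced by all words that may refine it.\<close>

lemma recognizable_ex:
  assumes "recognizable R"
  shows "recognizable (\<lambda>\<sigma>. \<exists>A\<in>fci. R (\<sigma>(v := A)))"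
proof -
  obtain N \<delta> q0 F where R: "q0 < (N::nat)" "\<forall>q<N. \<forall>a. \<delta> q a < N"
    "\<forall>ms. marking ms \<longrightarrow> (R (val ms) \<longleftrightarrow> foldl \<delta> q0 (map snd ms) \<in> F)"
    using assms unfolding recognizable_def by blast
  define \<Delta> where "\<Delta> S a = {foldl \<delta> s u | s u. s \<in> S \<and> u \<in> blocks v a}" for S a
  show ?thesis
  proof (rule recognizableI)
    show "finite (Pow {..<N})" "{q0} \<in> Pow {..<N}"
      using R(1) by auto
    show "\<Delta> S a \<in> Pow {..<N}" if "S \<in> Pow {..<N}" for S a
      using that foldl_closed[of "{..<N}" \<delta>] R(2) by (auto simp: \<Delta>_def)
    show "(\<exists>A\<in>fci. R ((val ms)(v := A))) \<longleftrightarrow> foldl \<Delta> {q0} (map snd ms) \<in> {S. S \<inter> F \<noteq> {}}"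
      if "marking ms" for ms
    proof -
      have "foldl \<Delta> {q0} (map snd ms) \<in> {S. S \<inter> F \<noteq> {}} \<longleftrightarrow>
          (\<exists>us. list_all2 (\<lambda>a u. u \<in> blocks v a) (map snd ms) us \<and> foldl \<delta> q0 (concat us) \<in> F)"
        unfolding \<Delta>_def foldl_subset_construction by auto
      also have "\<dots> \<longleftrightarrow> (\<exists>A\<in>fci. R ((val ms)(v := A)))"
      proof
        assume "\<exists>A\<in>fci. R ((val ms)(v := A))"
        then obtain A where "A \<in> fci" "R ((val ms)(v := A))"
          by blast
        then show "\<exists>us. list_all2 (\<lambda>a u. u \<in> blocks v a) (map snd ms) us \<and> foldl \<delta> q0 (concat us) \<in> F"
          using marking_refine[OF \<open>marking ms\<close>] R(3) by metis
      next
        assume "\<exists>us. list_all2 (\<lambda>a u. u \<in> blocks v a) (map snd ms) us \<and> foldl \<delta> q0 (concat us) \<in> F"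
        then obtain us where us: "list_all2 (\<lambda>a u. u \<in> blocks v a) (map snd ms) us"
            "foldl \<delta> q0 (concat us) \<in> F"
          by blast
        \<comment> \<open>Any accepted choice of blocks is realized by points, and the set decoded
          for \<open>v\<close> is the witness of the quantifier.\<close>
        obtain ms' where ms': "map snd ms' = concat us" "refines v ms ms'"
          using realize_blocks[OF _ us(1)] \<open>marking ms\<close> by (auto simp: marking_def)
        have "marking ms'"
          using \<open>marking ms\<close> ms'(2) by (auto simp: refines_def marking_def)
        moreover have "val ms' = (val ms)(v := val ms' v)"
          using ms'(2) by (intro ext) (simp add: refines_def)
        ultimately show "\<exists>A\<in>fci. R ((val ms)(v := A))"
          using R(3) us(2) ms'(1) val_fci by metis
      qed
      finally show ?thesis
        by blast
    qed
  qed
qed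

section \<open>Automata for inclusion and comparison of two sets\<close>

lemma val_ge_hd:
  assumes "increasing ms" "w \<in> val ms n"
  shows "ms \<noteq> [] \<and> fst (hd ms) \<le> w"
proof -
  obtain e where e: "e \<in> fst ` set ms" "e \<le> w"
    using assms(2) by (force simp: val_def cell_def)
  moreover have "fst (hd ms) \<le> e"
    using assms(1) e(1) by (cases ms) (auto intro: less_imp_le)
  ultimately show ?thesis
    by (cases ms) auto
qed

lemma increasing_Cons_hd: "increasing (m # ms) \<Longrightarrow> ms \<noteq> [] \<Longrightarrow> fst m < fst (hd ms)"
  by (cases ms) auto

lemma mem_cell_hd:
  assumes "increasing (m # ms)"
  shows "w \<in> cell (fst ` set ms) (fst m) \<longleftrightarrow> fst m \<le> w \<and> (ms \<noteq> [] \<longrightarrow> w \<le> fst (hd ms))"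
  using assms by (cases ms) (auto simp: cell_def intro: order.trans less_imp_le)

lemma cell_inner_point:
  fixes ms :: "('a \<times> letter) list"
  assumes "increasing (m # ms)"
  shows "\<exists>w. fst m < w \<and> (ms \<noteq> [] \<longrightarrow> w < fst (hd ms))"
  using no_top[of "fst m"] dense increasing_Cons_hd[OF assms] by (cases "ms = []") auto

lemma mem_val_Cons:
  assumes "increasing (m # ms)"
  shows "w \<in> val (m # ms) n \<longleftrightarrow> n \<in> fst (snd m) \<and> w = fst m \<or>
    n \<in> snd (snd m) \<and> fst m \<le> w \<and> (ms \<noteq> [] \<longrightarrow> w \<le> fst (hd ms)) \<or> w \<in> val ms n"
proof -
  obtain x p g where m: "m = (x, p, g)"
    by (cases m)
  show ?thesis
    using val_Cons[of x p g ms n] mem_cell_hd[of m ms w] assms m by auto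
qed

text \<open>The first bit tells whether the previous gap carries \<open>j\<close>: that gap is
  closed, so it puts the current point into the set \<open>j\<close> even if the current letter does
  not. The second bit says that no violation has occurred.\<close>

lemma recognizable_subset: "recognizable (\<lambda>\<sigma>. \<sigma> i \<subseteq> \<sigma> j)"
proof -
  define \<delta> :: "bool \<times> bool \<Rightarrow> letter \<Rightarrow> bool \<times> bool" where
    "\<delta> = (\<lambda>(b, ok) (p, g). (j \<in> g, ok \<and> (i \<in> p \<longrightarrow> j \<in> p \<union> g \<or> b) \<and> (i \<in> g \<longrightarrow> j \<in> g)))"
  \<comment> \<open>For an arbitrary starting state: with \<open>b\<close> set, the first point
    counts as covered, because the gap before it is not part of \<open>ms\<close>.\<close>
  have run: "snd (foldl \<delta> (b, ok) (map snd ms)) \<longleftrightarrow>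
      ok \<and> val ms i \<subseteq> val ms j \<union> (if b \<and> ms \<noteq> [] then {fst (hd ms)} else {})"
    if "increasing ms" for ms :: "('a \<times> letter) list" and b ok
    using that
  proof (induction ms arbitrary: b ok)
    case (Cons m ms)
    obtain x p g where m: "m = (x, p, g)"
      by (cases m)
    let ?h = "fst (hd ms)"
    have val: "w \<in> val (m # ms) n \<longleftrightarrow>
        n \<in> p \<and> w = x \<or> n \<in> g \<and> x \<le> w \<and> (ms \<noteq> [] \<longrightarrow> w \<le> ?h) \<or> w \<in> val ms n" for w n
      using mem_val_Cons[OF Cons.prems] m by simp
    have tail: "ms \<noteq> []" "?h \<le> w" if "w \<in> val ms n" for w n
      using val_ge_hd[OF _ that] Cons.prems by auto
    have xh: "x < ?h" if "ms \<noteq> []"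
      using increasing_Cons_hd[OF Cons.prems that] m by simp
    \<comment> \<open>A point inside the gap after \<open>x\<close>: the component \<open>g\<close>
      alone decides about it, so it exposes a gap carrying \<open>i\<close> without
      \<open>j\<close>.\<close>
    obtain u where u: "x < u" "ms \<noteq> [] \<longrightarrow> u < ?h"
      using cell_inner_point[OF Cons.prems] m by auto
    have u_tail: "u \<notin> val ms n" "x \<notin> val ms n" for n
      using tail[of u n] tail[of x n] u xh by auto
    have IH: "snd (foldl \<delta> (b, ok) (map snd (m # ms))) \<longleftrightarrow>
        (ok \<and> (i \<in> p \<longrightarrow> j \<in> p \<union> g \<or> b) \<and> (i \<in> g \<longrightarrow> j \<in> g)) \<and>
        val ms i \<subseteq> val ms j \<union> (if j \<in> g \<and> ms \<noteq> [] then {?h} else {})"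
      using Cons.IH Cons.prems by (simp add: m \<delta>_def)
    let ?r = "if b \<and> m # ms \<noteq> [] then {fst (hd (m # ms))} else {}"
    have r: "w \<in> ?r \<longleftrightarrow> b \<and> w = x" for w
      by (simp add: m)
    show ?case
      unfolding IH
    proof (intro iffI conjI; elim conjE)
      assume "i \<in> p \<longrightarrow> j \<in> p \<union> g \<or> b" "i \<in> g \<longrightarrow> j \<in> g"
        and sub: "val ms i \<subseteq> val ms j \<union> (if j \<in> g \<and> ms \<noteq> [] then {?h} else {})"
      moreover have "w \<in> val (m # ms) j" if "w \<in> val ms i" for w
        using subsetD[OF sub that] xh by (auto simp: val split: if_splits)
      ultimately have "w \<in> val (m # ms) j \<or> w \<in> ?r" if "w \<in> val (m # ms) i" for w
        using that xh unfolding r by (auto simp: val)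
      then show "val (m # ms) i \<subseteq> val (m # ms) j \<union> ?r"
        by blast
    next
      assume sub: "val (m # ms) i \<subseteq> val (m # ms) j \<union> ?r"
      then have sub': "w \<in> val (m # ms) j \<or> b \<and> w = x" if "w \<in> val (m # ms) i" for w
        using that r by blast
      show "i \<in> p \<longrightarrow> j \<in> p \<union> g \<or> b"
        using sub'[of x] u_tail by (auto simp: val)
      show "i \<in> g \<longrightarrow> j \<in> g"
        using sub'[of u] u u_tail by (simp add: val) (metis order.strict_iff_order)
      have "w \<in> val ms j \<or> j \<in> g \<and> w = ?h" if "w \<in> val ms i" for w
        using sub'[of w] that tail[OF that] xh by (auto simp: val)
      then show "val ms i \<subseteq> val ms j \<union> (if j \<in> g \<and> ms \<noteq> [] then {?h} else {})"
        using tail(1) by auto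
    qed
  qed simp
  show ?thesis
    by (rule recognizableI[of UNIV "(False, True)" \<delta> _ "{q. snd q}"])
      (auto simp: run marking_def)
qed

text \<open>The first bit tells whether an earlier letter contains \<open>j\<close>; after that,
  \<open>i\<close> must not occur. Within one letter, \<open>i\<close> in \<open>p\<close> is
  compatible with \<open>j\<close>, since equality is allowed, but \<open>i\<close> in
  \<open>g\<close> is not: the gap has points beyond its left end, which then belongs to
  \<open>j\<close>.\<close>

lemma recognizable_le: "recognizable (\<lambda>\<sigma>. \<forall>x\<in>\<sigma> i. \<forall>y\<in>\<sigma> j. x \<le> y)"
proof -
  define \<delta> :: "bool \<times> bool \<Rightarrow> letter \<Rightarrow> bool \<times> bool" where
    "\<delta> = (\<lambda>(b, ok) (p, g). (b \<or> j \<in> p \<union> g,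
        ok \<and> (i \<in> p \<longrightarrow> \<not> b) \<and> (i \<in> g \<longrightarrow> \<not> b \<and> j \<notin> p \<union> g)))"
  have run: "snd (foldl \<delta> (b, ok) (map snd ms)) \<longleftrightarrow>
      ok \<and> (b \<longrightarrow> val ms i = {}) \<and> (\<forall>x\<in>val ms i. \<forall>y\<in>val ms j. x \<le> y)"
    if "increasing ms" for ms :: "('a \<times> letter) list" and b ok
    using that
  proof (induction ms arbitrary: b ok)
    case (Cons m ms)
    obtain x p g where m: "m = (x, p, g)"
      by (cases m)
    let ?h = "fst (hd ms)"
    have val: "w \<in> val (m # ms) n \<longleftrightarrow>
        n \<in> p \<and> w = x \<or> n \<in> g \<and> x \<le> w \<and> (ms \<noteq> [] \<longrightarrow> w \<le> ?h) \<or> w \<in> val ms n" for w n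
      using mem_val_Cons[OF Cons.prems] m by simp
    have tail: "ms \<noteq> []" "?h \<le> w" if "w \<in> val ms n" for w n
      using val_ge_hd[OF _ that] Cons.prems by auto
    have xh: "x < ?h" if "ms \<noteq> []"
      using increasing_Cons_hd[OF Cons.prems that] m by simp
    have x_less: "x < w" if "w \<in> val ms n" for w n
      using tail[OF that] xh by auto
    have x_le: "x \<le> w" if "w \<in> val (m # ms) n" for w n
      using that x_less by (auto simp: val intro: less_imp_le)
    obtain u where u: "x < u" "ms \<noteq> [] \<longrightarrow> u < ?h"
      using cell_inner_point[OF Cons.prems] m by auto
    have IH: "snd (foldl \<delta> (b, ok) (map snd (m # ms))) \<longleftrightarrow>
        (ok \<and> (i \<in> p \<longrightarrow> \<not> b) \<and> (i \<in> g \<longrightarrow> \<not> b \<and> j \<notin> p \<union> g)) \<and>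
        (b \<or> j \<in> p \<union> g \<longrightarrow> val ms i = {}) \<and> (\<forall>x\<in>val ms i. \<forall>y\<in>val ms j. x \<le> y)"
      using Cons.IH Cons.prems by (simp add: m \<delta>_def)
    show ?case
      unfolding IH
    proof (intro iffI conjI; elim conjE)
      assume *: "i \<in> p \<longrightarrow> \<not> b" "i \<in> g \<longrightarrow> \<not> b \<and> j \<notin> p \<union> g"
        "b \<or> j \<in> p \<union> g \<longrightarrow> val ms i = {}" "\<forall>x\<in>val ms i. \<forall>y\<in>val ms j. x \<le> y"
      show "b \<longrightarrow> val (m # ms) i = {}"
        using * by (auto simp: val)
      show "\<forall>s\<in>val (m # ms) i. \<forall>t\<in>val (m # ms) j. s \<le> t"
      proof (intro ballI)
        fix s t
        assume s: "s \<in> val (m # ms) i" and t: "t \<in> val (m # ms) j"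
        consider "s = x" | "i \<in> g" "ms \<noteq> [] \<longrightarrow> s \<le> ?h" | "s \<in> val ms i"
          using s by (auto simp: val)
        then show "s \<le> t"
        proof cases
          case 2
          then have "t \<in> val ms j"
            using *(2) t by (auto simp: val)
          then show ?thesis
            using 2(2) tail by (blast intro: order.trans)
        next
          case 3
          then have "t \<in> val ms j"
            using *(3) t by (auto simp: val)
          then show ?thesis
            using 3 *(4) by blast
        qed (use x_le[OF t] in simp)
      qed
    next
      assume empty: "b \<longrightarrow> val (m # ms) i = {}"
        and le: "\<forall>s\<in>val (m # ms) i. \<forall>t\<in>val (m # ms) j. s \<le> t"
      have x_i: "x \<in> val (m # ms) i" if "i \<in> p \<union> g"
        using that xh by (auto simp: val)
      have x_j: "x \<in> val (m # ms) j" if "j \<in> p \<union> g"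
        using that xh by (auto simp: val)
      show "i \<in> p \<longrightarrow> \<not> b"
        using empty x_i by auto
      have "u \<in> val (m # ms) i" if "i \<in> g"
        using that u by (auto simp: val)
      then show "i \<in> g \<longrightarrow> \<not> b \<and> j \<notin> p \<union> g"
        using empty le x_j u(1) by force
      have "\<not> (b \<or> j \<in> p \<union> g)" if "s \<in> val ms i" for s
      proof -
        have "s \<in> val (m # ms) i"
          using that by (simp add: val)
        then show ?thesis
          using empty le x_j x_less[OF that] by force
      qed
      then show "b \<or> j \<in> p \<union> g \<longrightarrow> val ms i = {}"
        by blast
      show "\<forall>s\<in>val ms i. \<forall>t\<in>val ms j. s \<le> t"
        using le by (simp add: val)
    qed
  qed simp
  show ?thesis
    by (rule recognizableI[of UNIV "(False, True)" \<delta> _ "{q. snd q}"])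
      (auto simp: run marking_def)
qed

end

section \<open>Dependence on free variables\<close>

lemma teval_cong: "(\<And>n. n \<in> tvars t \<Longrightarrow> \<sigma> n = \<tau> n) \<Longrightarrow> teval z \<sigma> t = teval z \<tau> t"
  by (induction t) auto

lemma sat_cong: "(\<And>n. n \<in> fv p \<Longrightarrow> \<sigma> n = \<tau> n) \<Longrightarrow> sat z \<sigma> p \<longleftrightarrow> sat z \<tau> p"
proof (induction p arbitrary: \<sigma> \<tau>)
  case (FEq s t)
  show ?case
    using FEq teval_cong[of s \<sigma> \<tau> z] teval_cong[of t \<sigma> \<tau> z] by simp
next
  case (FNeg p)
  show ?case
    using FNeg.prems FNeg.IH[of \<sigma> \<tau>] by simp
next
  case (FAnd p q)
  show ?case
    using FAnd.prems FAnd.IH(1)[of \<sigma> \<tau>] FAnd.IH(2)[of \<sigma> \<tau>] by simp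
next
  case (FOr p q)
  show ?case
    using FOr.prems FOr.IH(1)[of \<sigma> \<tau>] FOr.IH(2)[of \<sigma> \<tau>] by simp
next
  case (FEx x p)
  have "sat z (\<sigma>(x := A)) p \<longleftrightarrow> sat z (\<tau>(x := A)) p" for A
    using FEx.prems by (intro FEx.IH) simp
  then show ?case
    by simp
next
  case (FAll x p)
  have "sat z (\<sigma>(x := A)) p \<longleftrightarrow> sat z (\<tau>(x := A)) p" for A
    using FAll.prems by (intro FAll.IH) simp
  then show ?case
    by simp
qed

lemma finite_tvars: "finite (tvars t)"
  by (induction t) auto

lemma finite_fv: "finite (fv p)"
  by (induction p) (auto simp: finite_tvars)

lemma fresh_var:
  assumes "finite (X :: nat set)"
  obtains k where "k \<notin> X"
  using ex_new_if_finite[OF infinite_UNIV_nat assms] by blast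

lemma teval_upd: "k \<notin> tvars t \<Longrightarrow> teval z (\<sigma>(k := A)) t = teval z \<sigma> t"
  by (rule teval_cong) auto

section \<open>First-order definitions over points, and recognizability of all formulas\<close>

context dense_ray
begin

text \<open>Expressed by the two automata at hand: comparison of the set with itself leaves at most
  one element, and it is nonempty iff some set, such as the empty one, fails to include it.
  \<open>Suc m\<close> is just a second variable.\<close>

lemma recognizable_singleton: "recognizable (\<lambda>\<sigma>. \<exists>a. \<sigma> m = {a})"
proof -
  have "recognizable (\<lambda>\<sigma>. (\<forall>x\<in>\<sigma> m. \<forall>y\<in>\<sigma> m. x \<le> y) \<and> \<not> \<not> (\<exists>A\<in>fci. \<not> (\<sigma>(Suc m := A)) m \<subseteq> (\<sigma>(Suc m := A)) (Suc m)))"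
    by (intro recognizable_conj recognizable_not recognizable_ex recognizable_le recognizable_subset)
  then show ?thesis
  proof (rule recognizable_cong)
    fix \<sigma> :: "nat \<Rightarrow> 'a set"
    have e: "(\<exists>A\<in>fci. \<not> (\<sigma>(Suc m := A)) m \<subseteq> (\<sigma>(Suc m := A)) (Suc m)) \<longleftrightarrow> \<sigma> m \<noteq> {}"
      using fci_empty by force
    show "(\<exists>a. \<sigma> m = {a}) \<longleftrightarrow> (\<forall>x\<in>\<sigma> m. \<forall>y\<in>\<sigma> m. x \<le> y) \<and>
        \<not> \<not> (\<exists>A\<in>fci. \<not> (\<sigma>(Suc m := A)) m \<subseteq> (\<sigma>(Suc m := A)) (Suc m))"
      unfolding e not_not
    proof
      assume le: "(\<forall>x\<in>\<sigma> m. \<forall>y\<in>\<sigma> m. x \<le> y) \<and> \<sigma> m \<noteq> {}"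
      then obtain a where a: "a \<in> \<sigma> m"
        by blast
      then have "x = a" if "x \<in> \<sigma> m" for x
        using le that by (simp add: order.antisym)
      then have "\<sigma> m = {a}"
        using a by blast
      then show "\<exists>a. \<sigma> m = {a}" ..
    next
      assume "\<exists>a. \<sigma> m = {a}"
      then obtain a where "\<sigma> m = {a}" ..
      then show "(\<forall>x\<in>\<sigma> m. \<forall>y\<in>\<sigma> m. x \<le> y) \<and> \<sigma> m \<noteq> {}"
        by simp
    qed
  qed
qed

lemma recognizable_ex_point:
  assumes "recognizable R"
  shows "recognizable (\<lambda>\<sigma>. \<exists>a. R (\<sigma>(m := {a})))"
proof -
  have "recognizable (\<lambda>\<sigma>. \<exists>A\<in>fci. (\<exists>a. (\<sigma>(m := A)) m = {a}) \<and> R (\<sigma>(m := A)))"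
    by (intro recognizable_ex recognizable_conj recognizable_singleton assms)
  then show ?thesis
    by (rule recognizable_cong) (auto intro: fci_singleton)
qed

lemma recognizable_all_point:
  assumes "recognizable R"
  shows "recognizable (\<lambda>\<sigma>. \<forall>a. R (\<sigma>(m := {a})))"
  using recognizable_not[OF recognizable_ex_point[OF recognizable_not[OF assms]]] by simp

text \<open>False unless variable \<open>m\<close> holds a point, so no separate side condition has
  to be carried through the recursion on terms.\<close>

definition point_in :: "nat \<Rightarrow> trm \<Rightarrow> (nat \<Rightarrow> 'a set) \<Rightarrow> bool" where
  "point_in m t \<sigma> \<longleftrightarrow> (\<exists>a. \<sigma> m = {a} \<and> a \<in> teval z \<sigma> t)"

definition point_le :: "nat \<Rightarrow> nat \<Rightarrow> (nat \<Rightarrow> 'a set) \<Rightarrow> bool" where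
  "point_le i j \<sigma> \<longleftrightarrow> (\<forall>x\<in>\<sigma> i. \<forall>y\<in>\<sigma> j. x \<le> y)"

lemma recognizable_point_le: "recognizable (point_le i j)"
  unfolding point_le_def[abs_def] by (rule recognizable_le)

text \<open>\<open>mem_left_ends_iff\<close> in the shape that \<open>point_le\<close> and
  \<open>point_in\<close> produce under Boolean connectives and point quantifiers.\<close>

lemma left_ends_first_order:
  fixes A :: "'a set"
  assumes "A \<in> fci"
  shows "x \<in> left_ends A \<longleftrightarrow> x \<in> A \<and> \<not> (\<exists>b. \<not> x \<le> b \<and> (\<forall>c. \<not> b \<le> c \<or> \<not> c \<le> x \<or> c \<in> A))"
proof -
  have "{b..x} \<subseteq> A \<longleftrightarrow> (\<forall>c. \<not> b \<le> c \<or> \<not> c \<le> x \<or> c \<in> A)" for b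
    by auto
  then show ?thesis
    by (simp only: mem_left_ends_iff[OF assms] not_le)
qed

lemma right_ends_first_order:
  fixes A :: "'a set"
  assumes "A \<in> fci"
  shows "x \<in> right_ends A \<longleftrightarrow> x \<in> A \<and> \<not> (\<exists>b. \<not> b \<le> x \<and> (\<forall>c. \<not> x \<le> c \<or> \<not> c \<le> b \<or> c \<in> A))"
proof -
  have "{x..b} \<subseteq> A \<longleftrightarrow> (\<forall>c. \<not> x \<le> c \<or> \<not> c \<le> b \<or> c \<in> A)" for b
    by auto
  then show ?thesis
    by (simp only: mem_right_ends_iff[OF assms] not_le)
qed

text \<open>The hypothesis ranges over all variables outside \<open>t\<close> because the
  definitions of ends, minimum and maximum test auxiliary points, held in the fresh variables
  \<open>k\<close> and \<open>l\<close>, for membership in \<open>t\<close>.\<close>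

lemma recognizable_point_in_ends:
  assumes IH: "\<And>k. k \<notin> tvars t \<Longrightarrow> recognizable (point_in k t)" and m: "m \<notin> tvars t"
  shows "recognizable (point_in m (TL t))" "recognizable (point_in m (TR t))"
    "recognizable (point_in m (TMin t))" "recognizable (point_in m (TMax t))"
proof -
  obtain k where k: "k \<notin> insert m (tvars t)"
    using fresh_var[of "insert m (tvars t)"] finite_tvars by auto
  obtain l where l: "l \<notin> insert k (insert m (tvars t))"
    using fresh_var[of "insert k (insert m (tvars t))"] finite_tvars by auto
  note rec = recognizable_conj recognizable_disj recognizable_not recognizable_ex_point recognizable_all_point
    recognizable_point_le IH recognizable_singleton
  have "recognizable (\<lambda>\<sigma>. point_in m t \<sigma> \<and>
     \<not> (\<exists>b. \<not> point_le m k (\<sigma>(k := {b})) \<and>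
       (\<forall>c. (\<not> point_le k l (\<sigma>(k := {b}, l := {c})) \<or> \<not> point_le l m (\<sigma>(k := {b}, l := {c})) \<or>
          point_in l t (\<sigma>(k := {b}, l := {c}))))))"
    by (intro rec IH m) (use l in auto)
  then show "recognizable (point_in m (TL t))"
  proof (rule recognizable_cong)
    fix \<sigma> :: "nat \<Rightarrow> 'a set"
    assume "\<And>n. \<sigma> n \<in> fci"
    then have "teval z \<sigma> t \<in> fci"
      by (rule teval_fci)
    then show "point_in m (TL t) \<sigma> \<longleftrightarrow> point_in m t \<sigma> \<and>
     \<not> (\<exists>b. \<not> point_le m k (\<sigma>(k := {b})) \<and>
       (\<forall>c. (\<not> point_le k l (\<sigma>(k := {b}, l := {c})) \<or> \<not> point_le l m (\<sigma>(k := {b}, l := {c})) \<or>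
          point_in l t (\<sigma>(k := {b}, l := {c})))))"
      using m k l by (cases "\<exists>a. \<sigma> m = {a}") (elim exE, simp_all add: point_in_def point_le_def teval_upd left_ends_first_order)
  qed
  have "recognizable (\<lambda>\<sigma>. point_in m t \<sigma> \<and>
     \<not> (\<exists>b. \<not> point_le k m (\<sigma>(k := {b})) \<and>
       (\<forall>c. (\<not> point_le m l (\<sigma>(k := {b}, l := {c})) \<or> \<not> point_le l k (\<sigma>(k := {b}, l := {c})) \<or>
          point_in l t (\<sigma>(k := {b}, l := {c}))))))"
    by (intro rec IH m) (use l in auto)
  then show "recognizable (point_in m (TR t))"
  proof (rule recognizable_cong)
    fix \<sigma> :: "nat \<Rightarrow> 'a set"
    assume "\<And>n. \<sigma> n \<in> fci"
    then have "teval z \<sigma> t \<in> fci"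
      by (rule teval_fci)
    then show "point_in m (TR t) \<sigma> \<longleftrightarrow> point_in m t \<sigma> \<and>
     \<not> (\<exists>b. \<not> point_le k m (\<sigma>(k := {b})) \<and>
       (\<forall>c. (\<not> point_le m l (\<sigma>(k := {b}, l := {c})) \<or> \<not> point_le l k (\<sigma>(k := {b}, l := {c})) \<or>
          point_in l t (\<sigma>(k := {b}, l := {c})))))"
      using m k l by (cases "\<exists>a. \<sigma> m = {a}") (elim exE, simp_all add: point_in_def point_le_def teval_upd right_ends_first_order)
  qed
  have "recognizable (\<lambda>\<sigma>. point_in m t \<sigma> \<and>
      \<not> (\<exists>b. point_in k t (\<sigma>(k := {b})) \<and> \<not> point_le m k (\<sigma>(k := {b}))))"
    by (intro rec IH m) (use k in auto)
  then show "recognizable (point_in m (TMin t))"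
  proof (rule recognizable_cong)
    fix \<sigma> :: "nat \<Rightarrow> 'a set"
    assume "\<And>n. \<sigma> n \<in> fci"
    then have "teval z \<sigma> t \<in> fci"
      by (rule teval_fci)
    then show "point_in m (TMin t) \<sigma> \<longleftrightarrow> point_in m t \<sigma> \<and>
        \<not> (\<exists>b. point_in k t (\<sigma>(k := {b})) \<and> \<not> point_le m k (\<sigma>(k := {b})))"
      using m k by (cases "\<exists>a. \<sigma> m = {a}") (auto simp: point_in_def point_le_def teval_upd mem_set_min_iff)
  qed
  have "recognizable (\<lambda>\<sigma>. point_in m t \<sigma> \<and>
      \<not> (\<exists>b. point_in k t (\<sigma>(k := {b})) \<and> \<not> point_le k m (\<sigma>(k := {b}))))"
    by (intro rec IH m) (use k in auto)
  then show "recognizable (point_in m (TMax t))"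
  proof (rule recognizable_cong)
    fix \<sigma> :: "nat \<Rightarrow> 'a set"
    assume "\<And>n. \<sigma> n \<in> fci"
    then have "teval z \<sigma> t \<in> fci"
      by (rule teval_fci)
    then show "point_in m (TMax t) \<sigma> \<longleftrightarrow> point_in m t \<sigma> \<and>
        \<not> (\<exists>b. point_in k t (\<sigma>(k := {b})) \<and> \<not> point_le k m (\<sigma>(k := {b})))"
      using m k by (cases "\<exists>a. \<sigma> m = {a}") (auto simp: point_in_def point_le_def teval_upd mem_set_max_iff)
  qed
qed

lemma recognizable_point_in: "m \<notin> tvars t \<Longrightarrow> recognizable (point_in m t)"
proof (induction t arbitrary: m)
  case (V n)
  have "recognizable (\<lambda>\<sigma>. (\<exists>a. \<sigma> m = {a}) \<and> \<sigma> m \<subseteq> \<sigma> n)"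
    by (intro recognizable_conj recognizable_singleton recognizable_subset)
  then show ?case
    by (rule recognizable_cong) (auto simp: point_in_def)
next
  case (TUn s t)
  then have "recognizable (\<lambda>\<sigma>. point_in m s \<sigma> \<or> point_in m t \<sigma>)"
    by (intro recognizable_disj) auto
  then show ?case
    by (rule recognizable_cong) (auto simp: point_in_def)
next
  case (TInt s t)
  then have "recognizable (\<lambda>\<sigma>. point_in m s \<sigma> \<and> point_in m t \<sigma>)"
    by (intro recognizable_conj) auto
  then show ?case
    by (rule recognizable_cong) (auto simp: point_in_def)
next
  case TBot
  have "recognizable (\<lambda>\<sigma>. (\<exists>a. \<sigma> m = {a}) \<and> \<not> (\<exists>a. \<sigma> m = {a}))"
    by (intro recognizable_conj recognizable_not recognizable_singleton)
  then show ?case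
    by (rule recognizable_cong) (auto simp: point_in_def)
next
  case TC0
  have least_iff: "(\<forall>b. a \<le> b) \<longleftrightarrow> a = z" for a
    using least antisym by blast
  \<comment> \<open>The point \<open>z\<close> is identified by lying below all points.\<close>
  have "recognizable (\<lambda>\<sigma>. (\<exists>a. \<sigma> m = {a}) \<and> (\<forall>b. point_le m (Suc m) (\<sigma>(Suc m := {b}))))"
    by (intro recognizable_conj recognizable_singleton recognizable_all_point recognizable_point_le)
  then show ?case
    by (rule recognizable_cong) (auto simp: point_in_def point_le_def least_iff least)
qed (auto intro: recognizable_point_in_ends)

lemma recognizable_sat: "recognizable (\<lambda>\<sigma>. sat z \<sigma> p)"
proof (induction p)
  case (FEq s t)
  obtain k where k: "k \<notin> tvars s \<union> tvars t"
    using fresh_var[of "tvars s \<union> tvars t"] finite_tvars by auto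
  \<comment> \<open>Extensionality turns an equation of terms into agreement on a point held in a
    fresh variable.\<close>
  have "recognizable (\<lambda>\<sigma>. \<forall>a. point_in k s (\<sigma>(k := {a})) \<longleftrightarrow> point_in k t (\<sigma>(k := {a})))"
    by (intro recognizable_all_point recognizable_iff recognizable_point_in) (use k in auto)
  then show ?case
    by (rule recognizable_cong) (use k in \<open>auto simp: point_in_def teval_upd\<close>)
next
  case (FAll x p)
  have "recognizable (\<lambda>\<sigma>. \<not> (\<exists>A\<in>fci. \<not> sat z (\<sigma>(x := A)) p))"
    by (intro recognizable_not recognizable_ex FAll.IH)
  then show ?case
    by simp
qed (auto intro: recognizable_not recognizable_conj recognizable_disj recognizable_ex)

end

section \<open>Runs as existential statements\<close>

definition next_in :: "'a::linorder set \<Rightarrow> 'a \<Rightarrow> 'a \<Rightarrow> bool" where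
  "next_in E u v \<longleftrightarrow> u \<in> E \<and> v \<in> E \<and> u < v \<and> (\<forall>e\<in>E. u < e \<longrightarrow> v \<le> e)"

lemma next_in_insert_less:
  assumes "\<forall>e\<in>E. x < e"
  shows "next_in (insert x E) u v \<longleftrightarrow> next_in E u v \<or> u = x \<and> v \<in> E \<and> (\<forall>e\<in>E. v \<le> e)"
  using assms by (auto simp: next_in_def dest: order.asym)

lemma next_in_unique: "next_in E u v \<Longrightarrow> next_in E u v' \<Longrightarrow> v = v'"
  unfolding next_in_def by (meson antisym)

section \<open>Definable predicates and the coding of runs by sets\<close>

context dense_ray
begin

text \<open>This and the next two notions replace formulas by predicates, which keeps syntax out of
  the argument about runs. \<open>X\<close> keeps track of the variables, since the final formula
  must not gain free ones.\<close>

definition term_definable :: "nat set \<Rightarrow> ((nat \<Rightarrow> 'a set) \<Rightarrow> 'a set) \<Rightarrow> bool" where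
  "term_definable X f \<longleftrightarrow> (\<exists>t. tvars t \<subseteq> X \<and> (\<forall>\<sigma>. teval z \<sigma> t = f \<sigma>))"

definition qf_definable :: "nat set \<Rightarrow> ((nat \<Rightarrow> 'a set) \<Rightarrow> bool) \<Rightarrow> bool" where
  "qf_definable X R \<longleftrightarrow> (\<exists>p. qfree p \<and> fv p \<subseteq> X \<and> (\<forall>\<sigma>. sat z \<sigma> p \<longleftrightarrow> R \<sigma>))"

definition ex_definable :: "nat set \<Rightarrow> ((nat \<Rightarrow> 'a set) \<Rightarrow> bool) \<Rightarrow> bool" where
  "ex_definable X R \<longleftrightarrow> (\<exists>p. existential p \<and> fv p \<subseteq> X \<and> (\<forall>\<sigma>. sat z \<sigma> p \<longleftrightarrow> R \<sigma>))"

lemma term_definable_var: "n \<in> X \<Longrightarrow> term_definable X (\<lambda>\<sigma>. \<sigma> n)"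
  unfolding term_definable_def by (rule exI[of _ "V n"]) simp

lemma term_definable_empty: "term_definable X (\<lambda>\<sigma>. {})"
  unfolding term_definable_def by (rule exI[of _ TBot]) simp

lemma term_definable_zero: "term_definable X (\<lambda>\<sigma>. {z})"
  unfolding term_definable_def by (rule exI[of _ TC0]) simp

lemma term_definable_Un:
  assumes "term_definable X f" "term_definable X g"
  shows "term_definable X (\<lambda>\<sigma>. f \<sigma> \<union> g \<sigma>)"
proof -
  obtain s t where "tvars s \<subseteq> X" "\<forall>\<sigma>. teval z \<sigma> s = f \<sigma>" "tvars t \<subseteq> X" "\<forall>\<sigma>. teval z \<sigma> t = g \<sigma>"
    using assms unfolding term_definable_def by blast
  then show ?thesis
    unfolding term_definable_def by (intro exI[of _ "TUn s t"]) simp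
qed

lemma term_definable_Int:
  assumes "term_definable X f" "term_definable X g"
  shows "term_definable X (\<lambda>\<sigma>. f \<sigma> \<inter> g \<sigma>)"
proof -
  obtain s t where "tvars s \<subseteq> X" "\<forall>\<sigma>. teval z \<sigma> s = f \<sigma>" "tvars t \<subseteq> X" "\<forall>\<sigma>. teval z \<sigma> t = g \<sigma>"
    using assms unfolding term_definable_def by blast
  then show ?thesis
    unfolding term_definable_def by (intro exI[of _ "TInt s t"]) simp
qed

lemma term_definable_ends:
  assumes "term_definable X f"
  shows "term_definable X (\<lambda>\<sigma>. left_ends (f \<sigma>))" "term_definable X (\<lambda>\<sigma>. right_ends (f \<sigma>))"
    "term_definable X (\<lambda>\<sigma>. set_max (f \<sigma>))"
proof -
  obtain t where t: "tvars t \<subseteq> X" "\<forall>\<sigma>. teval z \<sigma> t = f \<sigma>"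
    using assms unfolding term_definable_def by blast
  show "term_definable X (\<lambda>\<sigma>. left_ends (f \<sigma>))"
    unfolding term_definable_def by (rule exI[of _ "TL t"]) (simp add: t)
  show "term_definable X (\<lambda>\<sigma>. right_ends (f \<sigma>))"
    unfolding term_definable_def by (rule exI[of _ "TR t"]) (simp add: t)
  show "term_definable X (\<lambda>\<sigma>. set_max (f \<sigma>))"
    unfolding term_definable_def by (rule exI[of _ "TMax t"]) (simp add: t)
qed

lemma term_definable_UN:
  assumes "finite I" "\<And>i. i \<in> I \<Longrightarrow> term_definable X (f i)"
  shows "term_definable X (\<lambda>\<sigma>. \<Union>i\<in>I. f i \<sigma>)"
  using assms by (induction I) (simp_all add: term_definable_empty term_definable_Un)

lemma qf_definable_eq:
  assumes "term_definable X f" "term_definable X g"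
  shows "qf_definable X (\<lambda>\<sigma>. f \<sigma> = g \<sigma>)"
proof -
  obtain s t where "tvars s \<subseteq> X" "\<forall>\<sigma>. teval z \<sigma> s = f \<sigma>" "tvars t \<subseteq> X" "\<forall>\<sigma>. teval z \<sigma> t = g \<sigma>"
    using assms unfolding term_definable_def by blast
  then show ?thesis
    unfolding qf_definable_def by (intro exI[of _ "FEq s t"]) simp
qed

lemma qf_definable_subset:
  assumes "term_definable X f" "term_definable X g"
  shows "qf_definable X (\<lambda>\<sigma>. f \<sigma> \<subseteq> g \<sigma>)"
  using qf_definable_eq[OF term_definable_Un[OF assms] assms(2)] by (simp add: subset_Un_eq)

lemma qf_definable_not:
  assumes "qf_definable X R"
  shows "qf_definable X (\<lambda>\<sigma>. \<not> R \<sigma>)"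
proof -
  obtain p where "qfree p" "fv p \<subseteq> X" "\<forall>\<sigma>. sat z \<sigma> p \<longleftrightarrow> R \<sigma>"
    using assms unfolding qf_definable_def by blast
  then show ?thesis
    unfolding qf_definable_def by (intro exI[of _ "FNeg p"]) simp
qed

lemma qf_definable_conj:
  assumes "qf_definable X R" "qf_definable X R'"
  shows "qf_definable X (\<lambda>\<sigma>. R \<sigma> \<and> R' \<sigma>)"
proof -
  obtain p q where "qfree p" "fv p \<subseteq> X" "\<forall>\<sigma>. sat z \<sigma> p \<longleftrightarrow> R \<sigma>"
    "qfree q" "fv q \<subseteq> X" "\<forall>\<sigma>. sat z \<sigma> q \<longleftrightarrow> R' \<sigma>"
    using assms unfolding qf_definable_def by blast
  then show ?thesis
    unfolding qf_definable_def by (intro exI[of _ "FAnd p q"]) simp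
qed

lemma qf_definable_disj:
  assumes "qf_definable X R" "qf_definable X R'"
  shows "qf_definable X (\<lambda>\<sigma>. R \<sigma> \<or> R' \<sigma>)"
  using qf_definable_not[OF qf_definable_conj[OF assms[THEN qf_definable_not]]] by simp

lemma qf_definable_ball:
  assumes "finite I" "\<And>i. i \<in> I \<Longrightarrow> qf_definable X (R i)"
  shows "qf_definable X (\<lambda>\<sigma>. \<forall>i\<in>I. R i \<sigma>)"
  using assms
proof (induction I)
  case empty
  then show ?case
    using qf_definable_eq[OF term_definable_empty term_definable_empty] by simp
qed (simp add: qf_definable_conj)

lemma qf_definable_if:
  assumes "c \<Longrightarrow> qf_definable X R"
  shows "qf_definable X (\<lambda>\<sigma>. c \<longrightarrow> R \<sigma>)"
  using assms qf_definable_eq[OF term_definable_empty term_definable_empty] by (cases c) simp_all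

lemma ex_definable_ex:
  assumes "ex_definable (insert x X) R"
  shows "ex_definable X (\<lambda>\<sigma>. \<exists>A\<in>fci. R (\<sigma>(x := A)))"
proof -
  obtain p where "existential p" "fv p \<subseteq> insert x X" "\<forall>\<sigma>. sat z \<sigma> p \<longleftrightarrow> R \<sigma>"
    using assms unfolding ex_definable_def by blast
  then show ?thesis
    unfolding ex_definable_def by (intro exI[of _ "FEx x p"]) (auto intro: existential.intros)
qed

text \<open>A block of quantifiers amounts to one family that overwrites the assignment on
  \<open>Y\<close>. The added variable is quantified innermost, hence the induction over all
  \<open>R\<close>.\<close>

lemma ex_definable_ex_family:
  assumes "finite Y" "ex_definable (X \<union> Y) R"
  shows "ex_definable X (\<lambda>\<sigma>. \<exists>S. (\<forall>y\<in>Y. S y \<in> fci) \<and> R (\<lambda>n. if n \<in> Y then S n else \<sigma> n))"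
  using assms
proof (induction Y arbitrary: R)
  case empty
  then show ?case
    by simp
next
  case (insert y Y)
  have "ex_definable (X \<union> Y) (\<lambda>\<sigma>. \<exists>A\<in>fci. R (\<sigma>(y := A)))"
    using insert.prems by (intro ex_definable_ex) simp
  note IH = insert.IH[OF this]
  have eq: "(\<lambda>n. if n \<in> Y then S n else \<sigma> n)(y := A) =
      (\<lambda>n. if n \<in> insert y Y then (S(y := A)) n else \<sigma> n)" for S A and \<sigma> :: "nat \<Rightarrow> 'a set"
    using insert.hyps by (intro ext) auto
  have split: "(\<exists>S. (\<forall>i\<in>Y. S i \<in> fci) \<and> (\<exists>A\<in>fci. R ((\<lambda>n. if n \<in> Y then S n else \<sigma> n)(y := A)))) \<longleftrightarrow>
      (\<exists>S. (\<forall>i\<in>insert y Y. S i \<in> fci) \<and> R (\<lambda>n. if n \<in> insert y Y then S n else \<sigma> n))" for \<sigma>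
  proof
    assume "\<exists>S. (\<forall>i\<in>Y. S i \<in> fci) \<and> (\<exists>A\<in>fci. R ((\<lambda>n. if n \<in> Y then S n else \<sigma> n)(y := A)))"
    then obtain S A where S: "\<forall>i\<in>Y. S i \<in> fci" "A \<in> fci"
        "R (\<lambda>n. if n \<in> insert y Y then (S(y := A)) n else \<sigma> n)"
      unfolding eq by blast
    then have "\<forall>i\<in>insert y Y. (S(y := A)) i \<in> fci"
      by simp
    then show "\<exists>S. (\<forall>i\<in>insert y Y. S i \<in> fci) \<and> R (\<lambda>n. if n \<in> insert y Y then S n else \<sigma> n)"
      using S(3) by blast
  next
    assume "\<exists>S. (\<forall>i\<in>insert y Y. S i \<in> fci) \<and> R (\<lambda>n. if n \<in> insert y Y then S n else \<sigma> n)"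
    then obtain S where S: "\<forall>i\<in>insert y Y. S i \<in> fci" "R (\<lambda>n. if n \<in> insert y Y then S n else \<sigma> n)"
      by blast
    then have "R ((\<lambda>n. if n \<in> Y then S n else \<sigma> n)(y := S y))"
      unfolding eq fun_upd_triv by blast
    then show "\<exists>S. (\<forall>i\<in>Y. S i \<in> fci) \<and> (\<exists>A\<in>fci. R ((\<lambda>n. if n \<in> Y then S n else \<sigma> n)(y := A)))"
      using S(1) by blast
  qed
  show ?case
    using IH unfolding split .
qed

text \<open>A run of an automaton is coded by one set S t per tile t: the union of the cells on which the
  run uses t. If consecutive tiles differ, the cells can be recovered as the maximal intervals
  of the sets S t, so that the conditions for a run refer only to the ends of these sets.\<close>

definition tiling ::
    "'t set \<Rightarrow> 't set \<Rightarrow> 't set \<Rightarrow> ('t \<Rightarrow> 't \<Rightarrow> bool) \<Rightarrow> ('t \<Rightarrow> letter) \<Rightarrow> nat set \<Rightarrow> (nat \<Rightarrow> 'a set) \<Rightarrow> ('t \<Rightarrow> 'a set) \<Rightarrow> bool" where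
  "tiling T I F Nx lab W \<sigma> S \<longleftrightarrow>
     {z} \<subseteq> (\<Union>t\<in>T \<inter> I. left_ends (S t)) \<and>
     (\<forall>t\<in>T. right_ends (S t) \<subseteq> (\<Union>t'\<in>{t'\<in>T. Nx t t'}. left_ends (S t'))) \<and>
     (\<forall>t\<in>T. left_ends (S t) \<inter> right_ends (S t) = {}) \<and>
     (\<forall>t\<in>T. \<forall>t'\<in>T. t \<noteq> t' \<longrightarrow> left_ends (S t') \<inter> S t \<subseteq> right_ends (S t)) \<and>
     (\<forall>t\<in>T - F. S t = {} \<or> set_max (S t) \<noteq> {}) \<and>
     (\<forall>n\<in>W. \<sigma> n = (\<Union>t\<in>{t\<in>T. n \<in> snd (lab t)}. S t) \<union> (\<Union>t\<in>{t\<in>T. n \<in> fst (lab t)}. left_ends (S t)))"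

lemma tiling_cong:
  assumes "\<And>n. n \<in> W \<Longrightarrow> \<sigma> n = \<sigma>' n" "\<And>t. t \<in> T \<Longrightarrow> S t = S' t"
  shows "tiling T I F Nx lab W \<sigma> S \<longleftrightarrow> tiling T I F Nx lab W \<sigma>' S'"
  unfolding tiling_def using assms by (simp cong: SUP_cong_simp ball_cong_simp)

lemma qf_definable_tiling:
  assumes "finite T" "finite W"
  shows "qf_definable (W \<union> ix ` T) (\<lambda>\<sigma>. tiling T I F Nx lab W \<sigma> (\<lambda>t. \<sigma> (ix t)))"
  unfolding tiling_def
  by (intro qf_definable_conj qf_definable_ball qf_definable_subset qf_definable_eq qf_definable_disj
      qf_definable_not qf_definable_if term_definable_UN term_definable_Un term_definable_Int
      term_definable_zero term_definable_empty term_definable_ends term_definable_var)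
    (use assms in auto)

text \<open>The run itself, before it is coded by sets: \<open>\<tau> u\<close> is the tile on the
  cell that opens at \<open>u\<close>.\<close>

definition tiled :: "'t set \<Rightarrow> 't set \<Rightarrow> 't set \<Rightarrow> ('t \<Rightarrow> 't \<Rightarrow> bool) \<Rightarrow> 'a set \<Rightarrow> ('a \<Rightarrow> 't) \<Rightarrow> bool" where
  "tiled T I F Nx E \<tau> \<longleftrightarrow> finite E \<and> z \<in> E \<and> \<tau> ` E \<subseteq> T \<and> \<tau> z \<in> I \<and>
     (\<forall>u v. next_in E u v \<longrightarrow> Nx (\<tau> u) (\<tau> v)) \<and>
     (\<forall>u\<in>E. (\<forall>e\<in>E. e \<le> u) \<longrightarrow> \<tau> u \<in> F)"

definition tiled_val :: "('t \<Rightarrow> letter) \<Rightarrow> 'a set \<Rightarrow> ('a \<Rightarrow> 't) \<Rightarrow> nat \<Rightarrow> 'a set" where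
  "tiled_val lab E \<tau> n =
     {w. \<exists>u\<in>E. n \<in> fst (lab (\<tau> u)) \<and> w = u \<or> n \<in> snd (lab (\<tau> u)) \<and> w \<in> cell E u}"

text \<open>Decoding: the positions are the left ends of all the sets, and the tile at a position is
  the one whose set starts there.\<close>

lemma tiling_imp_tiled:
  assumes "finite T" and fci: "\<And>t. t \<in> T \<Longrightarrow> S t \<in> fci" and "tiling T I F Nx lab W \<sigma> S"
  shows "\<exists>E \<tau>. tiled T I F Nx E \<tau> \<and> (\<forall>n\<in>W. \<sigma> n = tiled_val lab E \<tau> n)"
proof -
  note tiling = assms(3)[unfolded tiling_def]
  have init: "\<exists>t\<in>T \<inter> I. z \<in> left_ends (S t)"
    using tiling[THEN conjunct1] by blast
  have succ: "\<exists>t'\<in>T. Nx t t' \<and> x \<in> left_ends (S t')" if "t \<in> T" "x \<in> right_ends (S t)" for t x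
    using tiling[THEN conjunct2, THEN conjunct1] that by blast
  \<comment> \<open>No maximal interval degenerates to a point.\<close>
  have disj: "x \<notin> right_ends (S t)" if "t \<in> T" "x \<in> left_ends (S t)" for t x
    using tiling[THEN conjunct2, THEN conjunct2, THEN conjunct1] that by blast
  \<comment> \<open>A tile can start on the set of another tile only where an interval of the latter
    stops.\<close>
  have sep: "x \<in> right_ends (S t)"
    if "t \<in> T" "t' \<in> T" "t \<noteq> t'" "x \<in> left_ends (S t')" "x \<in> S t" for t t' x
    using tiling[THEN conjunct2, THEN conjunct2, THEN conjunct2, THEN conjunct1] that by blast
  \<comment> \<open>Acceptance: the tile on the last, unbounded cell must be in \<open>F\<close>, so
    the sets of the other tiles are bounded.\<close>
  have fin: "S t = {} \<or> set_max (S t) \<noteq> {}" if "t \<in> T" "t \<notin> F" for t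
    using tiling[THEN conjunct2, THEN conjunct2, THEN conjunct2, THEN conjunct2, THEN conjunct1] that by blast
  have val: "\<sigma> n = (\<Union>t\<in>{t\<in>T. n \<in> snd (lab t)}. S t) \<union> (\<Union>t\<in>{t\<in>T. n \<in> fst (lab t)}. left_ends (S t))"
    if "n \<in> W" for n
    using tiling[THEN conjunct2, THEN conjunct2, THEN conjunct2, THEN conjunct2, THEN conjunct2] that by blast
  note left = mem_left_ends_iff[OF fci] and right = mem_right_ends_iff[OF fci]
  define E where "E = (\<Union>t\<in>T. left_ends (S t))"
  define \<tau> where "\<tau> u = (SOME t. t \<in> T \<and> u \<in> left_ends (S t))" for u
  \<comment> \<open>If two tiles started at \<open>u\<close>, then \<open>u\<close> would be both a
    left and a right end for one of them.\<close>
  have uniq: "t = t'" if "t \<in> T" "t' \<in> T" "u \<in> left_ends (S t)" "u \<in> left_ends (S t')" for t t' u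
    using sep[of t t' u] disj[of t u] left[of t u] that by blast
  have \<tau>: "\<tau> u \<in> T" "u \<in> left_ends (S (\<tau> u))" if "u \<in> E" for u
    using someI_ex[of "\<lambda>t. t \<in> T \<and> u \<in> left_ends (S t)"] that by (auto simp: \<tau>_def E_def)
  have \<tau>_eq: "\<tau> u = t" if "t \<in> T" "u \<in> left_ends (S t)" for u t
    using uniq[of "\<tau> u" t u] \<tau>[of u] that by (auto simp: E_def)
  \<comment> \<open>No position lies inside an interval of \<open>S t\<close>: it would have to be a
    left end of \<open>S t\<close> or, for another tile, a right end of \<open>S t\<close>.\<close>
  have inner: "w \<in> cell E i" if "t \<in> T" "i \<in> left_ends (S t)" "i \<le> w" "{i..w} \<subseteq> S t" for t i w
  proof -
    have "w \<le> e" if e: "e \<in> E" "i < e" for e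
    proof (rule ccontr)
      assume "\<not> w \<le> e"
      then have "e < w" "{i..e} \<subseteq> {i..w}" "{e..w} \<subseteq> {i..w}"
        using e(2) by auto
      then have w: "e < w" "{i..e} \<subseteq> S t" "{e..w} \<subseteq> S t"
        using \<open>{i..w} \<subseteq> S t\<close> by blast+
      then have "e \<notin> left_ends (S t)" "e \<notin> right_ends (S t)"
        using left[OF \<open>t \<in> T\<close>] right[OF \<open>t \<in> T\<close>] e(2) by blast+
      moreover have "e \<in> S t"
        using w(1,3) by (simp add: subset_iff)
      ultimately show False
        using sep[OF \<open>t \<in> T\<close> \<tau>(1)[OF e(1)] _ \<tau>(2)[OF e(1)]] \<tau>(2)[OF e(1)] by auto
    qed
    then show ?thesis
      using \<open>i \<le> w\<close> by (simp add: cell_def)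
  qed
  have component: "(\<exists>v. u < v \<and> {u..v} \<subseteq> S t \<and> v \<in> right_ends (S t)) \<or> {u..} \<subseteq> S t"
    if t: "t \<in> T" and u: "u \<in> left_ends (S t)" for t u
  proof -
    obtain C where C: "C \<in> max_intervals (S t)" "u \<in> C" "\<forall>y\<in>C. u \<le> y"
      using u by (auto simp: left_ends_def)
    have "C \<in> closed_intervals" "C \<subseteq> S t"
      using C(1) by (auto simp: max_intervals_def)
    then show ?thesis
    proof (cases rule: closed_intervals_cases)
      case (1 i v)
      then have "i \<in> C" "v \<in> C" "\<forall>y\<in>C. y \<le> v"
        using C(2) by auto
      then have v: "v \<in> right_ends (S t)"
        unfolding right_ends_def using C(1) by blast
      have "u \<le> i" "i \<le> u"
        using 1 C(2,3) \<open>i \<in> C\<close> by simp_all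
      then have "i = u"
        by (rule antisym[rotated])
      moreover have "u \<noteq> v"
        using disj[OF t u] v by blast
      moreover have "u \<le> v"
        using 1 C(2) by simp
      ultimately have "u < v" "{u..v} \<subseteq> S t"
        using 1 \<open>C \<subseteq> S t\<close> by simp_all
      then show ?thesis
        using v by blast
    next
      case (2 i)
      then have "{u..} \<subseteq> C"
        using C(2) by auto
      then show ?thesis
        using \<open>C \<subseteq> S t\<close> by blast
    qed
  qed
  have right_E: "v \<in> E \<and> Nx t (\<tau> v)" if "t \<in> T" "v \<in> right_ends (S t)" for t v
    using succ[OF that] \<tau>_eq by (auto simp: E_def)
  have cell_sub: "cell E u \<subseteq> S t" if t: "t \<in> T" and u: "u \<in> left_ends (S t)" for t u
  proof
    fix w
    assume w: "w \<in> cell E u"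
    from component[OF t u] show "w \<in> S t"
    proof
      assume "\<exists>v. u < v \<and> {u..v} \<subseteq> S t \<and> v \<in> right_ends (S t)"
      then obtain v where v: "u < v" "{u..v} \<subseteq> S t" "v \<in> E"
        using right_E[OF t] by blast
      then have "w \<in> {u..v}"
        using w by (simp add: cell_def)
      then show ?thesis
        using v(2) by blast
    next
      assume "{u..} \<subseteq> S t"
      then show ?thesis
        using w by (auto simp: cell_def)
    qed
  qed
  have S_eq: "S t = (\<Union>u\<in>{u\<in>E. \<tau> u = t}. cell E u)" if t: "t \<in> T" for t
  proof (intro equalityI subsetI)
    fix w
    assume "w \<in> S t"
    then obtain C where C: "C \<in> max_intervals (S t)" "w \<in> C"
      using fci_max_interval[OF fci[OF t]] by blast
    have C': "C \<in> closed_intervals" "C \<subseteq> S t"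
      using C(1) by (auto simp: max_intervals_def)
    obtain i where i: "i \<in> C" "\<forall>y\<in>C. i \<le> y" "{i..w} \<subseteq> C"
      using C'(1)
    proof (cases rule: closed_intervals_cases)
      case (1 i j)
      then have "i \<in> C" "\<forall>y\<in>C. i \<le> y" "{i..w} \<subseteq> C"
        using C(2) by auto
      then show thesis
        by (rule that)
    next
      case (2 i)
      then have "i \<in> C" "\<forall>y\<in>C. i \<le> y" "{i..w} \<subseteq> C"
        by auto
      then show thesis
        by (rule that)
    qed
    then have "i \<in> left_ends (S t)"
      using C(1) by (auto simp: left_ends_def)
    moreover from this have "w \<in> cell E i"
      using i C(2) C'(2) t by (intro inner) auto
    ultimately show "w \<in> (\<Union>u\<in>{u\<in>E. \<tau> u = t}. cell E u)"
      using \<tau>_eq[OF t] t by (auto simp: E_def)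
  next
    fix w
    assume "w \<in> (\<Union>u\<in>{u\<in>E. \<tau> u = t}. cell E u)"
    then show "w \<in> S t"
      using cell_sub \<tau> t by blast
  qed
  have L_eq: "left_ends (S t) = {u\<in>E. \<tau> u = t}" if "t \<in> T" for t
    using that \<tau> \<tau>_eq by (auto simp: E_def)
  have "finite E"
    using assms(1) by (auto simp: E_def intro: finite_left_ends fci)
  moreover have "z \<in> E" "\<tau> z \<in> I"
    using init \<tau>_eq by (auto simp: E_def)
  moreover have "Nx (\<tau> u) (\<tau> v)" if uv: "next_in E u v" for u v
  proof -
    have u: "u \<in> E" "u < v" "v \<in> E"
      using uv by (auto simp: next_in_def)
    from component[OF \<tau>[OF u(1)]] show ?thesis
    proof
      assume "\<exists>v. u < v \<and> {u..v} \<subseteq> S (\<tau> u) \<and> v \<in> right_ends (S (\<tau> u))"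
      then obtain v' where v': "u < v'" "{u..v'} \<subseteq> S (\<tau> u)" "v' \<in> right_ends (S (\<tau> u))"
        by blast
      then have "v' \<in> cell E u" "v' \<in> E"
        using inner[OF \<tau>[OF u(1)]] right_E[OF \<tau>(1)[OF u(1)]] by auto
      \<comment> \<open>The right end \<open>v'\<close> is a position and lies in the cell of
        \<open>u\<close>, so it is the position after \<open>u\<close> and equals
        \<open>v\<close>.\<close>
      then have "next_in E u v'"
        using v'(1) u(1) by (simp add: next_in_def cell_def)
      then show ?thesis
        using next_in_unique[OF uv] right_E[OF \<tau>(1)[OF u(1)] v'(3)] by blast
    next
      assume unb: "{u..} \<subseteq> S (\<tau> u)"
      obtain w where w: "v < w"
        using no_top by blast
      have "w \<in> cell E u"
        using unb w u(2) by (intro inner[OF \<tau>[OF u(1)]]) auto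
      then show ?thesis
        using w u by (auto simp: cell_def)
    qed
  qed
  moreover have "\<tau> u \<in> F" if u: "u \<in> E" "\<forall>e\<in>E. e \<le> u" for u
  proof (rule ccontr)
    assume "\<tau> u \<notin> F"
    \<comment> \<open>A right end would be a position beyond the last one, so the interval starting
      at \<open>u\<close> is a ray.\<close>
    have unb: "{u..} \<subseteq> S (\<tau> u)"
      using component[OF \<tau>[OF u(1)]] right_E[OF \<tau>(1)[OF u(1)]] u(2) leD by blast
    then have "set_max (S (\<tau> u)) \<noteq> {}"
      using fin[OF \<tau>(1)[OF u(1)] \<open>\<tau> u \<notin> F\<close>] \<tau>(2)[OF u(1)] left[OF \<tau>(1)[OF u(1)]] by blast
    then obtain b where b: "\<forall>x\<in>S (\<tau> u). x \<le> b"
      by (auto simp: set_max_def split: if_splits)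
    obtain w where w: "max u b < w"
      using no_top by blast
    then have "w \<in> S (\<tau> u)"
      using unb by auto
    then show False
      using b w by (simp add: leD)
  qed
  moreover have "\<sigma> n = tiled_val lab E \<tau> n" if "n \<in> W" for n
  proof -
    have "\<sigma> n = (\<Union>t\<in>{t\<in>T. n \<in> snd (lab t)}. \<Union>u\<in>{u\<in>E. \<tau> u = t}. cell E u) \<union>
        (\<Union>t\<in>{t\<in>T. n \<in> fst (lab t)}. {u\<in>E. \<tau> u = t})"
      unfolding val[OF that] by (intro arg_cong2[of _ _ _ _ "(\<union>)"] SUP_cong refl S_eq L_eq) auto
    also have "\<dots> = tiled_val lab E \<tau> n"
      using \<tau>(1) unfolding tiled_val_def by blast
    finally show ?thesis .
  qed
  ultimately have "tiled T I F Nx E \<tau> \<and> (\<forall>n\<in>W. \<sigma> n = tiled_val lab E \<tau> n)"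
    unfolding tiled_def using \<tau>(1) by blast
  then show ?thesis
    by blast
qed

text \<open>Encoding. The hypothesis \<open>change\<close> prevents two neighbouring cells from
  fusing into one interval, which would hide the position between them from the end point
  operations.\<close>

lemma tiled_imp_tiling:
  assumes "tiled T I F Nx E \<tau>" and change: "\<And>u v. next_in E u v \<Longrightarrow> \<tau> u \<noteq> \<tau> v"
    and val: "\<And>n. n \<in> W \<Longrightarrow> \<sigma> n = tiled_val lab E \<tau> n"
  shows "\<exists>S. (\<forall>t. S t \<in> fci) \<and> tiling T I F Nx lab W \<sigma> S"
proof -
  have E: "finite E" "z \<in> E" "\<tau> z \<in> I" and T: "\<And>u. u \<in> E \<Longrightarrow> \<tau> u \<in> T"
    and Nx: "\<And>u v. next_in E u v \<Longrightarrow> Nx (\<tau> u) (\<tau> v)"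
    and fin: "\<And>u. u \<in> E \<Longrightarrow> \<forall>e\<in>E. e \<le> u \<Longrightarrow> \<tau> u \<in> F"
    using assms(1) by (auto simp: tiled_def)
  define S where "S t = (\<Union>u\<in>{u\<in>E. \<tau> u = t}. cell E u)" for t
  have fci: "S t \<in> fci" for t
    unfolding S_def using E(1) by (intro fci_UN fci_interval cell_closed_interval) auto
  note left = mem_left_ends_iff[OF fci] and right = mem_right_ends_iff[OF fci]
  have cell_S: "cell E u \<subseteq> S (\<tau> u)" if "u \<in> E" for u
    using that by (auto simp: S_def)
  have germ_right: "\<exists>w. u < w \<and> w < y \<and> w \<notin> E \<and> w \<in> cell E u" if "u < y" for u y
    using between_finite_right[OF E(1) that] by (force simp: cell_def intro: less_imp_le)
  have L_eq: "left_ends (S t) = {u\<in>E. \<tau> u = t}" for t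
  proof (intro equalityI subsetI)
    fix u
    assume u: "u \<in> left_ends (S t)"
    then obtain v where v: "v \<in> E" "\<tau> v = t" "u \<in> cell E v"
      using left by (auto simp: S_def)
    have "{v..u} \<subseteq> S t"
      using v cell_S[OF v(1)] cell_convex[OF v(3)] by auto
    then have "\<not> v < u"
      using u left by blast
    then have "u = v"
      using v(3) by (auto simp: cell_def)
    then show "u \<in> {u\<in>E. \<tau> u = t}"
      using v by simp
  next
    fix u
    assume u: "u \<in> {u\<in>E. \<tau> u = t}"
    have "\<not> {y..u} \<subseteq> S t" if "y < u" for y
    proof
      assume sub: "{y..u} \<subseteq> S t"
      \<comment> \<open>\<open>w\<close> lies beyond all positions before \<open>u\<close>, so its
        cell belongs to the predecessor of \<open>u\<close>; having the same tile there contradicts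
        \<open>change\<close>.\<close>
      obtain w where w: "y < w" "w < u" "\<forall>e\<in>E. e < u \<longrightarrow> e < w"
        using between_finite_left[OF E(1) \<open>y < u\<close>] by blast
      then have "w \<in> S t"
        by (intro subsetD[OF sub]) (simp add: less_imp_le)
      then obtain v where v: "v \<in> E" "\<tau> v = t" "w \<in> cell E v"
        by (auto simp: S_def)
      have "next_in E v u"
        using u v w unfolding next_in_def cell_def by force
      then show False
        using change u v(2) by blast
    qed
    moreover have "u \<in> S t"
      using u cell_self[of u E] cell_S[of u] by auto
    ultimately show "u \<in> left_ends (S t)"
      using left by blast
  qed
  have R: "\<exists>u. \<tau> u = t \<and> next_in E u x" if x: "x \<in> right_ends (S t)" for t x
  proof -
    obtain u where u: "u \<in> E" "\<tau> u = t" "x \<in> cell E u"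
      using x right by (auto simp: S_def)
    \<comment> \<open>A right end leaves nothing of the cell on its right, so \<open>x\<close> must
      be the point where the cell of \<open>u\<close> closes.\<close>
    have no: "y \<notin> cell E u" if "x < y" for y
    proof
      assume y: "y \<in> cell E u"
      have "u \<le> x"
        using u(3) by (simp add: cell_def)
      then have "{x..y} \<subseteq> cell E u"
        using cell_convex[OF y] by auto
      then have "{x..y} \<subseteq> S t"
        using cell_S[OF u(1)] u(2) by blast
      then show False
        using x right that by blast
    qed
    from E(1) show ?thesis
    proof (cases rule: cell_cases[of E u])
      case (1 e)
      then have "\<not> x < e" "x \<le> e"
        using u(3) no[of e] by auto
      then have "x = e"
        by simp
      then show ?thesis
        using 1 u by (auto simp: next_in_def)
    next
      case 2
      obtain y where "x < y"
        using no_top by blast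
      then show ?thesis
        using 2 no[of y] u(3) by auto
    qed
  qed
  have not_R: "x \<notin> right_ends (S (\<tau> x))" if "x \<in> E" for x
  proof
    assume x: "x \<in> right_ends (S (\<tau> x))"
    obtain y where "x < y"
      using no_top by blast
    then obtain w where w: "x < w" "w \<in> cell E x"
      using germ_right by blast
    then have "{x..w} \<subseteq> S (\<tau> x)"
      using cell_S[OF that] cell_convex[OF w(2)] by auto
    then show False
      using x w(1) right by blast
  qed
  have sep: "x \<in> right_ends (S t)" if x: "x \<in> E" "\<tau> x \<noteq> t" "x \<in> S t" for x t
  proof -
    have "\<not> {x..y} \<subseteq> S t" if "x < y" for y
    proof
      assume sub: "{x..y} \<subseteq> S t"
      \<comment> \<open>Unlike \<open>x\<close>, the point \<open>w\<close> lies in a single cell,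
        namely that of \<open>x\<close>, and the tile there is not \<open>t\<close>.\<close>
      obtain w where w: "x < w" "w < y" "w \<notin> E" "w \<in> cell E x"
        using germ_right[OF \<open>x < y\<close>] by blast
      then have "w \<in> S t"
        by (intro subsetD[OF sub]) (simp add: less_imp_le)
      then obtain v where "v \<in> E" "\<tau> v = t" "w \<in> cell E v"
        by (auto simp: S_def)
      then show False
        using cell_overlap[of x E v w] w x by auto
    qed
    then show ?thesis
      using right x(3) by blast
  qed
  have bounded: "S t = {} \<or> set_max (S t) \<noteq> {}" if "t \<notin> F" for t
  proof -
    \<comment> \<open>A tile outside \<open>F\<close> never sits at the last position, so each of
      its cells closes at or before the last position.\<close>
    have "w \<le> Max E" if w: "w \<in> S t" for w
    proof -
      obtain u where u: "u \<in> E" "\<tau> u = t" "w \<in> cell E u"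
        using w by (auto simp: S_def)
      then obtain e where "e \<in> E" "u < e"
        using fin[OF u(1)] \<open>t \<notin> F\<close> linorder_not_le by blast
      then show ?thesis
        using u(3) E(1) by (auto simp: cell_def intro: order.trans)
    qed
    then show ?thesis
      by (auto simp: set_max_def)
  qed
  have "tiling T I F Nx lab W \<sigma> S"
    unfolding tiling_def
  proof (intro conjI ballI impI)
    show "{z} \<subseteq> (\<Union>t\<in>T \<inter> I. left_ends (S t))"
      using E T by (auto simp: L_eq)
    show "right_ends (S t) \<subseteq> (\<Union>t'\<in>{t'\<in>T. Nx t t'}. left_ends (S t'))" for t
    proof
      fix x
      assume "x \<in> right_ends (S t)"
      then obtain u where u: "\<tau> u = t" "next_in E u x"
        using R by blast
      then have "x \<in> E"
        by (simp add: next_in_def)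
      then show "x \<in> (\<Union>t'\<in>{t'\<in>T. Nx t t'}. left_ends (S t'))"
        using Nx[OF u(2)] u(1) T by (auto simp: L_eq)
    qed
    show "left_ends (S t) \<inter> right_ends (S t) = {}" for t
      using not_R by (auto simp: L_eq)
    show "left_ends (S t') \<inter> S t \<subseteq> right_ends (S t)" if "t \<noteq> t'" for t t'
      using sep that by (auto simp: L_eq)
    show "S t = {} \<or> set_max (S t) \<noteq> {}" if "t \<in> T - F" for t
      using bounded that by auto
    show "\<sigma> n = (\<Union>t\<in>{t\<in>T. n \<in> snd (lab t)}. S t) \<union> (\<Union>t\<in>{t\<in>T. n \<in> fst (lab t)}. left_ends (S t))"
      if "n \<in> W" for n
    proof -
      have "(\<Union>t\<in>{t\<in>T. n \<in> snd (lab t)}. S t) \<union> (\<Union>t\<in>{t\<in>T. n \<in> fst (lab t)}. left_ends (S t)) =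
          tiled_val lab E \<tau> n"
        unfolding L_eq unfolding S_def tiled_val_def using T by blast
      then show ?thesis
        using val[OF that] by simp
    qed
  qed
  then show ?thesis
    using fci by blast
qed

end

section \<open>Tiles and runs of automata\<close>

definition mark :: "('t \<Rightarrow> letter) \<Rightarrow> ('a \<Rightarrow> 't) \<Rightarrow> 'a list \<Rightarrow> ('a \<times> letter) list" where
  "mark lab \<tau> us = map (\<lambda>u. (u, lab (\<tau> u))) us"

lemma set_mark: "fst ` set (mark lab \<tau> us) = set us"
  by (simp add: mark_def image_image)

lemma val_mark: "w \<in> val (mark lab \<tau> us) n \<longleftrightarrow>
    (\<exists>u\<in>set us. n \<in> fst (lab (\<tau> u)) \<and> w = u \<or> n \<in> snd (lab (\<tau> u)) \<and> w \<in> cell (set us) u)"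
proof -
  have "w \<in> val (mark lab \<tau> us) n \<longleftrightarrow>
      (\<exists>m\<in>set (mark lab \<tau> us). n \<in> fst (snd m) \<and> w = fst m \<or> n \<in> snd (snd m) \<and> w \<in> cell (set us) (fst m))"
    unfolding val_def set_mark by (simp add: case_prod_beta)
  then show ?thesis
    by (simp add: mark_def)
qed

type_synonym tile = "nat \<times> letter \<times> bool"

text \<open>A tile (q, a, b) stands for a position where the state q reads the letter a. The parity bit b
  makes consecutive tiles different.\<close>

definition tile_letter :: "tile \<Rightarrow> letter" where
  "tile_letter t = fst (snd t)"

definition tile_step :: "(nat \<Rightarrow> letter \<Rightarrow> nat) \<Rightarrow> tile \<Rightarrow> nat" where
  "tile_step \<delta> t = \<delta> (fst t) (tile_letter t)"

text \<open>Each tile's state is forced by its predecessor, so the tiles follow the actual run, and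
  the step of the last tile gives the state after the whole word.\<close>

lemma run_of_tiles:
  assumes "sorted_wrt (<) us" "us \<noteq> []"
    and "\<And>u v. next_in (set us) u v \<Longrightarrow> fst (\<tau> v) = tile_step \<delta> (\<tau> u)"
  shows "\<exists>u\<in>set us. (\<forall>e\<in>set us. e \<le> u) \<and>
    foldl \<delta> (fst (\<tau> (hd us))) (map (\<lambda>u. tile_letter (\<tau> u)) us) = tile_step \<delta> (\<tau> u)"
  using assms
proof (induction us)
  case (Cons u us)
  show ?case
  proof (cases us)
    case Nil
    then show ?thesis
      by (simp add: tile_step_def)
  next
    case (Cons v vs)
    have less: "\<forall>e\<in>set us. u < e"
      using Cons.prems(1) by simp
    have "next_in (set (u # us)) u v"
      using Cons.prems(1) Cons by (auto simp: next_in_def intro: less_imp_le)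
    then have v: "fst (\<tau> v) = tile_step \<delta> (\<tau> u)"
      by (rule Cons.prems(3))
    have "fst (\<tau> v) = tile_step \<delta> (\<tau> u)" if "next_in (set us) u v" for u v
      using that Cons.prems(3) next_in_insert_less[OF less] by simp
    then obtain w where w: "w \<in> set us" "\<forall>e\<in>set us. e \<le> w"
        "foldl \<delta> (fst (\<tau> (hd us))) (map (\<lambda>u. tile_letter (\<tau> u)) us) = tile_step \<delta> (\<tau> w)"
      using Cons.IH Cons.prems(1) Cons by auto
    have "foldl \<delta> (fst (\<tau> (hd (u # us)))) (map (\<lambda>u. tile_letter (\<tau> u)) (u # us)) = tile_step \<delta> (\<tau> w)"
      using w(3) v Cons by (simp add: tile_step_def)
    then show ?thesis
      using w(1,2) less by (auto intro: less_imp_le)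
  qed
qed simp

text \<open>The start state and the parity are arbitrary so that the induction can treat the tail
  from the next state with the opposite bit.\<close>

lemma tiles_of_run:
  assumes "increasing ms" "q < N" "\<And>q a. q < N \<Longrightarrow> \<delta> q a < N"
  shows "\<exists>\<tau>. (\<forall>m\<in>set ms. tile_letter (\<tau> (fst m)) = snd m \<and> fst (\<tau> (fst m)) < N) \<and>
     (ms \<noteq> [] \<longrightarrow> fst (\<tau> (fst (hd ms))) = q \<and> snd (snd (\<tau> (fst (hd ms)))) = b) \<and>
     (\<forall>u v. next_in (fst ` set ms) u v \<longrightarrow>
        fst (\<tau> v) = tile_step \<delta> (\<tau> u) \<and> snd (snd (\<tau> v)) \<noteq> snd (snd (\<tau> u))) \<and>
     (\<forall>u\<in>fst ` set ms. (\<forall>e\<in>fst ` set ms. e \<le> u) \<longrightarrow> tile_step \<delta> (\<tau> u) = foldl \<delta> q (map snd ms))"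
  using assms(1,2)
proof (induction ms arbitrary: q b)
  case Nil
  then show ?case
    by (simp add: next_in_def)
next
  case (Cons m ms)
  let ?E = "fst ` set ms"
  obtain \<tau> where \<tau>: "\<forall>m\<in>set ms. tile_letter (\<tau> (fst m)) = snd m \<and> fst (\<tau> (fst m)) < N"
     "ms \<noteq> [] \<longrightarrow> fst (\<tau> (fst (hd ms))) = \<delta> q (snd m) \<and> snd (snd (\<tau> (fst (hd ms)))) = (\<not> b)"
     "\<And>u v. next_in ?E u v \<Longrightarrow>
        fst (\<tau> v) = tile_step \<delta> (\<tau> u) \<and> snd (snd (\<tau> v)) \<noteq> snd (snd (\<tau> u))"
     "\<forall>u\<in>?E. (\<forall>e\<in>?E. e \<le> u) \<longrightarrow> tile_step \<delta> (\<tau> u) = foldl \<delta> (\<delta> q (snd m)) (map snd ms)"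
    using Cons.IH[of "\<delta> q (snd m)" "\<not> b"] Cons.prems assms(3) by auto
  define \<tau>' where "\<tau>' = \<tau>(fst m := (q, snd m, b))"
  have less: "\<forall>e\<in>?E. fst m < e"
    using Cons.prems(1) by simp
  have \<tau>'_m: "\<tau>' (fst m) = (q, snd m, b)"
    by (simp add: \<tau>'_def)
  have \<tau>'_E: "\<tau>' e = \<tau> e" if "e \<in> ?E" for e
    using less that by (auto simp: \<tau>'_def)
  have "tile_letter (\<tau>' (fst k)) = snd k \<and> fst (\<tau>' (fst k)) < N" if "k \<in> set (m # ms)" for k
  proof (cases "k = m")
    case True
    then show ?thesis
      using Cons.prems(2) by (simp add: \<tau>'_m tile_letter_def)
  next
    case False
    then show ?thesis
      using that \<tau>(1) \<tau>'_E[of "fst k"] by simp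
  qed
  moreover have "fst (\<tau>' v) = tile_step \<delta> (\<tau>' u) \<and> snd (snd (\<tau>' v)) \<noteq> snd (snd (\<tau>' u))"
    if uv: "next_in (fst ` set (m # ms)) u v" for u v
  proof -
    have "next_in (insert (fst m) ?E) u v"
      using uv by simp
    then consider "next_in ?E u v" | "u = fst m" "v \<in> ?E" "\<forall>e\<in>?E. v \<le> e"
      using next_in_insert_less[OF less, of u v] by blast
    then show ?thesis
    proof cases
      case 1
      then have "u \<in> ?E" "v \<in> ?E"
        by (auto simp: next_in_def)
      then show ?thesis
        using \<tau>(3)[OF 1] \<tau>'_E by simp
    next
      case 2
      then obtain m' ms' where ms: "ms = m' # ms'"
        by (cases ms) auto
      then have "v = fst m'"
        using 2(2,3) Cons.prems(1) by (auto intro: antisym less_imp_le)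
      then show ?thesis
        using 2 ms \<tau>(2) \<tau>'_E[OF 2(2)] \<tau>'_m by (simp add: tile_step_def tile_letter_def)
    qed
  qed
  moreover have "tile_step \<delta> (\<tau>' u) = foldl \<delta> q (map snd (m # ms))"
    if u: "u \<in> fst ` set (m # ms)" "\<forall>e\<in>fst ` set (m # ms). e \<le> u" for u
  proof (cases "ms = []")
    case True
    then show ?thesis
      using u by (simp add: \<tau>'_m tile_step_def tile_letter_def)
  next
    case False
    then obtain e where "e \<in> ?E"
      by fastforce
    then have "u \<noteq> fst m"
      using u(2) less by force
    then have E: "u \<in> ?E"
      using u(1) by simp
    moreover have "\<forall>e\<in>?E. e \<le> u"
      using u(2) by simp
    ultimately have "tile_step \<delta> (\<tau> u) = foldl \<delta> (\<delta> q (snd m)) (map snd ms)"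
      using \<tau>(4) by blast
    then show ?thesis
      by (simp add: \<tau>'_E[OF E])
  qed
  ultimately show ?case
    using \<tau>'_m by (intro exI[of _ \<tau>']) simp
qed

section \<open>Equivalence of formulas with existential statements about tiles\<close>

context dense_ray
begin

text \<open>A tile holds the state before its letter is read, so acceptance is tested on
  \<open>tile_step\<close> of the last tile. Restricting letters to \<open>W\<close> leaves finitely
  many tiles when \<open>W\<close> is finite.\<close>

definition accepting_tiles :: "nat \<Rightarrow> (nat \<Rightarrow> letter \<Rightarrow> nat) \<Rightarrow> nat \<Rightarrow> nat set \<Rightarrow> nat set \<Rightarrow> 'a set \<Rightarrow> ('a \<Rightarrow> tile) \<Rightarrow> bool" where
  "accepting_tiles N \<delta> q0 F W E \<tau> \<longleftrightarrow> tiled ({..<N} \<times> (Pow W \<times> Pow W) \<times> UNIV) {t. fst t = q0} {t. tile_step \<delta> t \<in> F}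
     (\<lambda>t t'. fst t' = tile_step \<delta> t) E \<tau>"

lemma marking_of_tiles:
  assumes "accepting_tiles N \<delta> q0 F W E \<tau>"
  shows "\<exists>ms. marking ms \<and> val ms = tiled_val tile_letter E \<tau> \<and> foldl \<delta> q0 (map snd ms) \<in> F"
proof -
  have E: "finite E" "z \<in> E" "fst (\<tau> z) = q0"
    and step: "\<And>u v. next_in E u v \<Longrightarrow> fst (\<tau> v) = tile_step \<delta> (\<tau> u)"
    and final: "\<And>u. u \<in> E \<Longrightarrow> \<forall>e\<in>E. e \<le> u \<Longrightarrow> tile_step \<delta> (\<tau> u) \<in> F"
    using assms by (auto simp: accepting_tiles_def tiled_def)
  define us where "us = sorted_list_of_set E"
  have us: "set us = E" "sorted_wrt (<) us" "us \<noteq> []"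
    using E(1,2) by (auto simp: us_def)
  have hd: "hd us = z"
    using us E(2) least by (cases us) (auto simp: not_less intro: antisym dest: leD)
  have marking: "marking (mark tile_letter \<tau> us)"
    using us hd by (cases us) (auto simp: marking_def increasing_def mark_def o_def)
  have "val (mark tile_letter \<tau> us) = tiled_val tile_letter E \<tau>"
    by (intro ext set_eqI) (simp add: val_mark us(1) tiled_val_def)
  moreover have "foldl \<delta> q0 (map snd (mark tile_letter \<tau> us)) \<in> F"
    using run_of_tiles[OF us(2,3), of \<tau> \<delta>] step final hd E(3) us(1) by (auto simp: mark_def o_def)
  ultimately show ?thesis
    using marking by blast
qed

lemma tiles_of_marking:
  assumes "marking ms" "foldl \<delta> q0 (map snd ms) \<in> F" "q0 < N" "\<And>q a. q < N \<Longrightarrow> \<delta> q a < N"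
    and W: "\<forall>m\<in>set ms. fst (snd m) \<subseteq> W \<and> snd (snd m) \<subseteq> W"
  shows "\<exists>E \<tau>. accepting_tiles N \<delta> q0 F W E \<tau> \<and> (\<forall>u v. next_in E u v \<longrightarrow> \<tau> u \<noteq> \<tau> v) \<and>
     val ms = tiled_val tile_letter E \<tau>"
proof -
  let ?E = "fst ` set ms"
  have ms: "increasing ms" "ms \<noteq> []" "fst (hd ms) = z"
    using assms(1) by (auto simp: marking_def)
  obtain \<tau> where \<tau>: "\<forall>m\<in>set ms. tile_letter (\<tau> (fst m)) = snd m \<and> fst (\<tau> (fst m)) < N"
      "fst (\<tau> z) = q0"
      "\<And>u v. next_in ?E u v \<Longrightarrow> fst (\<tau> v) = tile_step \<delta> (\<tau> u) \<and> snd (snd (\<tau> v)) \<noteq> snd (snd (\<tau> u))"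
      "\<forall>u\<in>?E. (\<forall>e\<in>?E. e \<le> u) \<longrightarrow> tile_step \<delta> (\<tau> u) = foldl \<delta> q0 (map snd ms)"
    using tiles_of_run[OF ms(1) assms(3), of \<delta> True] assms(4) ms(2,3) by auto
  have "\<tau> (fst m) \<in> {..<N} \<times> (Pow W \<times> Pow W) \<times> UNIV" if "m \<in> set ms" for m
  proof -
    have "fst (\<tau> (fst m)) < N" "fst (snd (\<tau> (fst m))) = snd m"
      using \<tau>(1) that by (auto simp: tile_letter_def)
    then show ?thesis
      using W that by (simp add: mem_Times_iff)
  qed
  then have "\<tau> ` ?E \<subseteq> {..<N} \<times> (Pow W \<times> Pow W) \<times> UNIV"
    by (simp only: image_image image_subset_iff) blast
  moreover have "z \<in> ?E"
    using ms(2,3) hd_in_set by fastforce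
  ultimately have "accepting_tiles N \<delta> q0 F W ?E \<tau>"
    unfolding accepting_tiles_def tiled_def using \<tau>(2-4) assms(2) by simp
  moreover have "\<tau> u \<noteq> \<tau> v" if "next_in ?E u v" for u v
    using \<tau>(3)[OF that] by metis
  moreover have "val ms = tiled_val tile_letter ?E \<tau>"
  proof (intro ext set_eqI)
    fix n w
    have "w \<in> tiled_val tile_letter ?E \<tau> n \<longleftrightarrow> (\<exists>m\<in>set ms. n \<in> fst (tile_letter (\<tau> (fst m))) \<and> w = fst m \<or>
        n \<in> snd (tile_letter (\<tau> (fst m))) \<and> w \<in> cell ?E (fst m))"
      by (simp add: tiled_val_def)
    moreover have "\<dots> \<longleftrightarrow> w \<in> val ms n"
      unfolding val_def mem_Collect_eq using \<tau>(1) by (intro bex_cong) (auto simp: case_prod_beta)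
    ultimately show "w \<in> val ms n \<longleftrightarrow> w \<in> tiled_val tile_letter ?E \<tau> n"
      by blast
  qed
  ultimately show ?thesis
    by blast
qed

text \<open>Discards marks for other variables, so that the word fits the finite supply of
  tiles.\<close>

lemma marking_restrict:
  assumes "marking ms"
  shows "\<exists>ms'. marking ms' \<and> (\<forall>m\<in>set ms'. fst (snd m) \<subseteq> W \<and> snd (snd m) \<subseteq> W) \<and>
    (\<forall>n\<in>W. val ms' n = val ms n)"
proof -
  define f where "f m = (fst m, fst (snd m) \<inter> W, snd (snd m) \<inter> W)" for m :: "'a \<times> letter"
  have "fst \<circ> f = fst"
    by (auto simp: f_def)
  then have "marking (map f ms)"
    using assms by (cases ms) (auto simp: marking_def increasing_def f_def)
  moreover have "val (map f ms) n = val ms n" if "n \<in> W" for n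
  proof -
    have "fst ` set (map f ms) = fst ` set ms"
      by (simp add: image_image f_def)
    then show ?thesis
      using that unfolding val_def by (simp add: case_prod_beta f_def)
  qed
  ultimately show ?thesis
    by (intro exI[of _ "map f ms"]) (auto simp: f_def)
qed

text \<open>\<open>R\<close> asserts that some sets tile an accepting run over the free variables of
  \<open>p\<close>. The agreement with \<open>sat\<close> is limited to \<open>fci\<close> because
  only such families have words.\<close>

lemma sat_ex_definable: "\<exists>R. ex_definable (fv p) R \<and> (\<forall>\<sigma>. (\<forall>n. \<sigma> n \<in> fci) \<longrightarrow> (R \<sigma> \<longleftrightarrow> sat z \<sigma> p))"
proof -
  let ?W = "fv p"
  obtain N \<delta> q0 F where aut: "q0 < (N::nat)" "\<forall>q<N. \<forall>a. \<delta> q a < N"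
    "\<forall>ms. marking ms \<longrightarrow> (sat z (val ms) p \<longleftrightarrow> foldl \<delta> q0 (map snd ms) \<in> F)"
    using recognizable_sat[of p] unfolding recognizable_def by blast
  define T :: "tile set" where "T = {..<N} \<times> (Pow ?W \<times> Pow ?W) \<times> UNIV"
  have "finite T"
    by (simp add: T_def finite_fv)
  \<comment> \<open>One variable per tile, kept apart from the free variables so that guessing the
    run does not overwrite the input.\<close>
  obtain B where B: "B \<subseteq> - ?W" "finite B" "card B = card T"
    using infinite_arbitrarily_large[of "- ?W" "card T"] finite_fv[of p]
    by (metis Compl_eq_Diff_UNIV Diff_infinite_finite infinite_UNIV_nat)
  obtain ix where ix: "bij_betw ix T B"
    using finite_same_card_bij[OF \<open>finite T\<close> B(2)] B(3) by auto
  have inj: "inj_on ix T" and ix_W: "\<And>t. t \<in> T \<Longrightarrow> ix t \<notin> ?W"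
    using ix B(1) by (auto simp: bij_betw_def)
  define tiles where "tiles = tiling T {t. fst t = q0} {t. tile_step \<delta> t \<in> F} (\<lambda>t t'. fst t' = tile_step \<delta> t) tile_letter ?W"
  \<comment> \<open>The conditionals are those of \<open>ex_definable_ex_family\<close>: tile
    \<open>t\<close> reads its set from the overwritten variable \<open>ix t\<close>.\<close>
  define R where "R \<sigma> \<longleftrightarrow> (\<exists>S. (\<forall>y\<in>ix ` T. S y \<in> fci) \<and>
      tiles (\<lambda>n. if n \<in> ix ` T then S n else \<sigma> n) (\<lambda>t. if ix t \<in> ix ` T then S (ix t) else \<sigma> (ix t)))" for \<sigma>
  have "qf_definable (?W \<union> ix ` T) (\<lambda>\<sigma>. tiles \<sigma> (\<lambda>t. \<sigma> (ix t)))"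
    unfolding tiles_def by (intro qf_definable_tiling \<open>finite T\<close> finite_fv)
  then have "ex_definable (?W \<union> ix ` T) (\<lambda>\<sigma>. tiles \<sigma> (\<lambda>t. \<sigma> (ix t)))"
    unfolding qf_definable_def ex_definable_def by (auto intro: existential.intros)
  then have "ex_definable ?W R"
    unfolding R_def using ex_definable_ex_family[of "ix ` T" ?W] \<open>finite T\<close> by simp
  moreover have "R \<sigma> \<longleftrightarrow> sat z \<sigma> p" if fci: "\<And>n. \<sigma> n \<in> fci" for \<sigma>
  proof
    assume "R \<sigma>"
    then obtain S where S: "\<forall>y\<in>ix ` T. S y \<in> fci"
        "tiles (\<lambda>n. if n \<in> ix ` T then S n else \<sigma> n) (\<lambda>t. if ix t \<in> ix ` T then S (ix t) else \<sigma> (ix t))"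
      unfolding R_def by blast
    then obtain E \<tau> where E: "accepting_tiles N \<delta> q0 F ?W E \<tau>"
        "\<forall>n\<in>?W. (if n \<in> ix ` T then S n else \<sigma> n) = tiled_val tile_letter E \<tau> n"
      using tiling_imp_tiled[OF \<open>finite T\<close> _ S(2)[unfolded tiles_def]] fci
      unfolding accepting_tiles_def T_def[symmetric] by auto
    obtain ms where ms: "marking ms" "val ms = tiled_val tile_letter E \<tau>" "foldl \<delta> q0 (map snd ms) \<in> F"
      using marking_of_tiles[OF E(1)] by blast
    have "val ms n = \<sigma> n" if "n \<in> ?W" for n
    proof -
      have "n \<notin> ix ` T"
        using ix_W that by blast
      then show ?thesis
        using bspec[OF E(2) that] ms(2) by simp
    qed
    then show "sat z \<sigma> p"
      using sat_cong[of p "val ms" \<sigma> z] aut(3) ms(1,3) by blast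
  next
    assume "sat z \<sigma> p"
    obtain ms where ms: "marking ms" "\<forall>n\<in>?W. val ms n = \<sigma> n"
      using marking_exists[OF finite_fv[of p], of \<sigma>] fci by blast
    obtain ms' where ms': "marking ms'" "\<forall>m\<in>set ms'. fst (snd m) \<subseteq> ?W \<and> snd (snd m) \<subseteq> ?W"
        "\<forall>n\<in>?W. val ms' n = \<sigma> n"
      using marking_restrict[OF ms(1), of ?W] ms(2) by auto
    \<comment> \<open>The word agrees with \<open>\<sigma>\<close> on the free variables only, and
      this is all that the truth of \<open>p\<close> depends on.\<close>
    then have run: "foldl \<delta> q0 (map snd ms') \<in> F"
      using sat_cong[of p "val ms'" \<sigma> z] aut(3) \<open>sat z \<sigma> p\<close> by blast
    have "\<delta> q a < N" if "q < N" for q a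
      using aut(2) that by blast
    from tiles_of_marking[OF ms'(1) run aut(1) this ms'(2)]
    obtain E \<tau> where E: "accepting_tiles N \<delta> q0 F ?W E \<tau>" "\<forall>u v. next_in E u v \<longrightarrow> \<tau> u \<noteq> \<tau> v"
        "val ms' = tiled_val tile_letter E \<tau>"
      by blast
    have "\<exists>S. (\<forall>t. S t \<in> fci) \<and> tiles \<sigma> S"
      unfolding tiles_def T_def
    proof (rule tiled_imp_tiling[OF E(1)[unfolded accepting_tiles_def]])
      show "\<tau> u \<noteq> \<tau> v" if "next_in E u v" for u v
        using E(2) that by blast
      show "\<sigma> n = tiled_val tile_letter E \<tau> n" if "n \<in> ?W" for n
        using ms'(3) E(3) that by simp
    qed
    then obtain S where S: "\<And>t. S t \<in> fci" "tiles \<sigma> S"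
      by blast
    define S' where "S' y = S (inv_into T ix y)" for y
    have S': "S' (ix t) = S t" if "t \<in> T" for t
      using inj that by (simp add: S'_def)
    have "tiles (\<lambda>n. if n \<in> ix ` T then S' n else \<sigma> n) (\<lambda>t. if ix t \<in> ix ` T then S' (ix t) else \<sigma> (ix t)) \<longleftrightarrow>
        tiles \<sigma> S"
      unfolding tiles_def by (rule tiling_cong) (use S' ix_W in auto)
    then show "R \<sigma>"
      unfolding R_def using S by (intro exI[of _ S']) (auto simp: S'_def)
  qed
  ultimately show ?thesis
    by blast
qed

end

theorem theorem7p1:
  fixes z :: "'a::linorder"
  assumes dense: "\<And>x y::'a. x < y \<Longrightarrow> \<exists>w. x < w \<and> w < y"
    and left_end: "\<And>x::'a. z \<le> x"
    and no_right_end: "\<And>x::'a. \<exists>y. x < y"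
  shows "\<forall>\<phi>. \<exists>\<psi>. existential \<psi> \<and> fv \<psi> \<subseteq> fv \<phi> \<and>
           (\<forall>\<sigma>. (\<forall>n. \<sigma> n \<in> fci) \<longrightarrow> (sat z \<sigma> \<psi> \<longleftrightarrow> sat z \<sigma> \<phi>))"
proof
  fix \<phi>
  interpret dense_ray z
    using assms by unfold_locales
  obtain R where "ex_definable (fv \<phi>) R" "\<forall>\<sigma>. (\<forall>n. \<sigma> n \<in> fci) \<longrightarrow> (R \<sigma> \<longleftrightarrow> sat z \<sigma> \<phi>)"
    using sat_ex_definable[of \<phi>] by blast
  then show "\<exists>\<psi>. existential \<psi> \<and> fv \<psi> \<subseteq> fv \<phi> \<and>
      (\<forall>\<sigma>. (\<forall>n. \<sigma> n \<in> fci) \<longrightarrow> (sat z \<sigma> \<psi> \<longleftrightarrow> sat z \<sigma> \<phi>))"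
    unfolding ex_definable_def by metis
qed

end
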